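(* Let $p$ and $q$ be monic polynomials of degree $d$ having only nonnegative real roots. Then for every $w>0$, \[ \mathcal{R}_{\mathbb{S}(p\boxplus\!\boxplus_d q)}(w)\le \mathcal{R}_{\mathbb{S}p}(w)+\mathcal{R}_{\mathbb{S}q}(w). \]
   Context: $\mathbb{S}$ maps a polynomial $p(x)$ to $p(x^2)$ (so if $p$ has degree $d$ and nonnegative roots $\lambda_i$, $\mathbb{S}p$ has degree $2d$ and roots $\pm\sqrt{\lambda_i}$). For a real-rooted polynomial $r$ of degree $n$ with roots $\lambda_1,\dots,\lambda_n$: $\mathcal{G}_r(x)=\frac1n\sum_i\frac1{x-\lambda_i}$, $\mathcal{K}_r(w)=\max\{x:\mathcal{G}_r(x)=w\}$, $\mathcal{R}_r(w)=\mathcal{K}_r(w)-1/w$. The asymmetric additive convolution: for $p=\sum_i x^{d-i}(-1)^ia_i$, $q=\sum_i x^{d-i}(-1)^ib_i$, $p\boxplus\!\boxplus_d q=\sum_{k=0}^d x^{d-k}(-1)^k\sum_{i+j=k}\left(\frac{(d-i)!(d-j)!}{d!(d-i-j)!}\right)^2a_ib_j$; equivalently $\mathbb{E}_{R,Q}\det(xI-(A+RBQ)(A+RBQ)^T)$ where $\det(xI-AA^T)=p$, $\det(xI-BB^T)=q$ and $R,Q$ are independent Haar-random orthogonal matrices. *)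

theory Defs
  imports "HOL-Analysis.Analysis" "HOL-Computational_Algebra.Computational_Algebra"
begin

text \<open>The roots are taken over the complex numbers, so the predicate also says that the real
  polynomial is real-rooted.\<close>

definition only_nonneg_real_roots :: "real poly \<Rightarrow> bool" where
  "only_nonneg_real_roots p \<longleftrightarrow>
     (\<forall>z. poly (map_poly complex_of_real p) z = 0 \<longrightarrow> z \<in> \<real>\<^sub>\<ge>\<^sub>0)"

definition sq_subst :: "real poly \<Rightarrow> real poly" where
  "sq_subst p = pcompose p (monom 1 2)"

text \<open>\<open>proots r\<close> is the multiset of real roots of \<open>r\<close> (with multiplicity); the transforms below are
  meant for real-rooted \<open>r\<close> of positive degree.\<close>

definition cauchy_transform :: "real poly \<Rightarrow> real \<Rightarrow> real" where
  "cauchy_transform r x = 1 / real (degree r) * (\<Sum>t\<in>#proots r. 1 / (x - t))"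

text \<open>The transform is not defined at the roots of \<open>r\<close>. They are excluded explicitly because \<open>1 / 0 = 0\<close>
  would give it a spurious value there.\<close>

definition K_transform :: "real poly \<Rightarrow> real \<Rightarrow> real" where
  "K_transform r w = (GREATEST x. poly r x \<noteq> 0 \<and> cauchy_transform r x = w)"

definition R_transform :: "real poly \<Rightarrow> real \<Rightarrow> real" where
  "R_transform r w = K_transform r w - 1 / w"

text \<open>The coefficient \<open>a\<^sub>i\<close> in \<open>p = \<Sum>\<^sub>i x\<^sup>d\<^sup>-\<^sup>i (-1)\<^sup>i a\<^sub>i\<close>.\<close>

definition signed_coeff :: "nat \<Rightarrow> real poly \<Rightarrow> nat \<Rightarrow> real" where
  "signed_coeff d p i = (-1) ^ i * coeff p (d - i)"

text \<open>The inner sum over \<open>i + j = k\<close> is written with \<open>j = k - i\<close>, so that \<open>d - i - j\<close> becomes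
  \<open>d - k\<close>; no subtraction is truncated, since \<open>i \<le> k \<le> d\<close>.\<close>

definition asym_add_conv :: "nat \<Rightarrow> real poly \<Rightarrow> real poly \<Rightarrow> real poly" where
  "asym_add_conv d p q =
     (\<Sum>k\<le>d. monom ((-1) ^ k *
        (\<Sum>i\<le>k. (fact (d - i) * fact (d - (k - i)) / (fact d * fact (d - k)))\<^sup>2
                  * signed_coeff d p i * signed_coeff d q (k - i))) (d - k))"

end

theory Submission
  imports Defs
begin

text \<open>Put \<open>\<alpha> = 1 / (2 d w)\<close>. Then \<open>y \<ge> \<K>\<close> of \<open>\<S>p\<close> at \<open>w\<close> means that \<open>y\<^sup>2\<close> lies above the roots of
  \<open>p\<close> and \<open>2 \<alpha> y p'(y\<^sup>2) \<le> p(y\<^sup>2)\<close>, a condition that is linear in \<open>p\<close>. The claim says that if it holds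
  for \<open>p\<close> at \<open>s\<close> and for \<open>q\<close> at \<open>t\<close>, it holds for the convolution at \<open>s + t - 2 d \<alpha>\<close>. By induction on
  \<open>d\<close>, this is preserved when \<open>p\<close> is written as \<open>p\<^sub>1 + C p\<^sub>2\<close> with \<open>C > 0\<close>, where \<open>p\<^sub>1\<close> has two roots of \<open>p\<close>
  moved towards each other, \<open>p\<^sub>2\<close> has degree \<open>d - 1\<close>, and \<open>p'(s\<^sup>2) / p(s\<^sup>2)\<close> is the same for all three.
  Convolving with \<open>p\<^sub>2\<close> is a convolution in degree \<open>d - 1\<close> with \<open>(x q')'\<close>, for which \<open>t\<close> may be lowered by
  \<open>2 \<alpha>\<close>. Finitely many such moves lead to \<open>p = (x - l)\<^sup>d\<close>, \<open>q = (x - m)\<^sup>d\<close>, whose convolution is a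
  rescaled Chebyshev polynomial of the second kind.

  The convolution has only nonnegative roots because \<open>(z, u) \<mapsto> p(- z u)\<close> has no zero with
  \<open>z\<close> and \<open>u\<close> in the open right half-plane, and in these two variables the convolution is the symmetric
  finite free convolution taken in \<open>z\<close> and then in \<open>u\<close>, each of which preserves this property.\<close>

subsection \<open>Polynomials given by their roots\<close>

definition root_poly :: "'a::comm_ring_1 multiset \<Rightarrow> 'a poly" where
  "root_poly M = (\<Prod>a\<in>#M. [:- a, 1:])"

lemma root_poly_empty [simp]: "root_poly {#} = 1"
  by (simp add: root_poly_def)

lemma root_poly_add [simp]: "root_poly (add_mset a M) = [:- a, 1:] * root_poly M"
  by (simp add: root_poly_def)

lemma root_poly_neq_0 [simp]: "root_poly M \<noteq> (0 :: 'a::idom poly)"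
  by (induction M) (simp_all del: mult_pCons_left)

lemma degree_root_poly [simp]: "degree (root_poly M :: 'a::idom poly) = size M"
proof (induction M)
  case (add a M)
  then show ?case
    by (simp add: degree_mult_eq del: mult_pCons_left)
qed auto

lemma lead_coeff_root_poly [simp]: "coeff (root_poly M :: 'a::idom poly) (size M) = 1"
proof -
  have "lead_coeff (root_poly M) = (1 :: 'a)"
    by (induction M) (simp_all add: lead_coeff_mult del: mult_pCons_left)
  then show ?thesis by simp
qed

lemma poly_root_poly_eq_0_iff: "poly (root_poly M) x = 0 \<longleftrightarrow> (x :: 'a::idom) \<in># M"
  by (induction M) (auto simp: algebra_simps)

lemma proots_root_poly [simp]: "proots (root_poly M :: 'a::idom poly) = M"
proof (induction M)
  case (add a M)
  then show ?case
    by (simp add: proots_mult del: mult_pCons_left)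
qed auto

lemma poly_root_poly_pos:
  fixes x :: real
  assumes "\<forall>a\<in>#M. a < x"
  shows "poly (root_poly M) x > 0"
  using assms by (induction M) (auto simp: algebra_simps mult_strict_right_mono)

text \<open>The logarithmic derivative of \<open>root_poly M\<close>, by
  \<open>poly_pderiv_root_poly\<close>. The field is left open because both real and complex roots
  occur.\<close>

definition rsum :: "'a::field multiset \<Rightarrow> 'a \<Rightarrow> 'a" where
  "rsum M x = (\<Sum>a\<in>#M. 1 / (x - a))"

lemma rsum_empty [simp]: "rsum {#} x = 0"
  by (simp add: rsum_def)

lemma rsum_add [simp]: "rsum (add_mset a M) x = 1 / (x - a) + rsum M x"
  by (simp add: rsum_def)

lemma poly_pderiv_root_poly:
  fixes x :: "'a::field_char_0"
  assumes "x \<notin># M"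
  shows "poly (pderiv (root_poly M)) x = poly (root_poly M) x * rsum M x"
  using assms
proof (induction M)
  case (add a M)
  then have "x - a \<noteq> 0" by auto
  have "poly (pderiv (root_poly (add_mset a M))) x
      = poly (root_poly M) x + (x - a) * poly (pderiv (root_poly M)) x"
    by (simp only: root_poly_add pderiv_mult) (simp add: pderiv_pCons algebra_simps)
  also have "poly (pderiv (root_poly M)) x = poly (root_poly M) x * rsum M x"
    using add by simp
  also have "poly (root_poly M) x + (x - a) * (poly (root_poly M) x * rsum M x)
      = (x - a) * poly (root_poly M) x * (1 / (x - a) + rsum M x)"
    using \<open>x - a \<noteq> 0\<close> by (simp add: field_simps)
  finally show ?case
    by (simp add: algebra_simps)
qed auto

text \<open>This is f'' / f = (f' / f)^2 + (f' / f)' with \<open>rsum M\<close> in the place of f' /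
  f.\<close>

lemma poly_pderiv2_root_poly:
  fixes x :: "'a::field_char_0"
  assumes "x \<notin># M"
  shows "poly (pderiv (pderiv (root_poly M))) x
       = poly (root_poly M) x * ((rsum M x)\<^sup>2 - (\<Sum>a\<in>#M. (1 / (x - a))\<^sup>2))"
  using assms
proof (induction M)
  case (add a M)
  then have nz: "x - a \<noteq> 0" and x: "x \<notin># M" by auto
  have "poly (pderiv (pderiv (root_poly (add_mset a M)))) x
      = 2 * poly (pderiv (root_poly M)) x + (x - a) * poly (pderiv (pderiv (root_poly M))) x"
    by (simp only: root_poly_add pderiv_mult pderiv_add) (simp add: pderiv_pCons algebra_simps)
  also have "\<dots> = (x - a) * poly (root_poly M) x
      * (2 * (1 / (x - a)) * rsum M x + ((rsum M x)\<^sup>2 - (\<Sum>a\<in>#M. (1 / (x - a))\<^sup>2)))"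
    using nz unfolding add.IH[OF x] poly_pderiv_root_poly[OF x] by (simp add: field_simps)
  also have "\<dots> = poly (root_poly (add_mset a M)) x
      * ((rsum (add_mset a M) x)\<^sup>2 - (\<Sum>a\<in>#add_mset a M. (1 / (x - a))\<^sup>2))"
    by (simp add: power2_eq_square algebra_simps)
  finally show ?case .
qed auto

lemma rsum_pos:
  fixes x :: real
  assumes "\<forall>a\<in>#M. a < x" "M \<noteq> {#}"
  shows "rsum M x > 0"
  using assms
proof (induction M)
  case (add a M)
  then show ?case
    by (cases "M = {#}") (auto intro: add_pos_pos)
qed auto

lemma rsum_nonneg:
  fixes x :: real
  assumes "\<forall>a\<in>#M. a < x"
  shows "rsum M x \<ge> 0"
  using rsum_pos[OF assms] by (cases "M = {#}") auto

lemma poly_pderiv_root_poly_pos: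
  fixes x :: real
  assumes "\<forall>a\<in>#M. a < x" "M \<noteq> {#}"
  shows "poly (pderiv (root_poly M)) x > 0"
proof -
  have "x \<notin># M" using assms by auto
  then show ?thesis
    using poly_root_poly_pos[OF assms(1)] rsum_pos[OF assms] by (simp add: poly_pderiv_root_poly)
qed

text \<open>The barrier step: with \<open>X = \<eta> / (x - \<eta> - a)\<close> the hypothesis reads
  \<open>\<Sum> X / (1 + X) \<le> 1\<close> and the conclusion \<open>(\<Sum> X)\<^sup>2 - \<Sum> X\<^sup>2 \<le> \<Sum> X\<close>, which is the
  Cauchy--Schwarz inequality for \<open>X / (1 + X)\<close> and \<open>X * (1 + X)\<close>.\<close>

lemma pderiv_barrier:
  fixes x \<eta> :: real
  assumes M: "\<forall>a\<in>#M. a < x" "size M \<ge> 2" and \<eta>: "\<eta> > 0" "\<eta> * rsum M x \<le> 1"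
  shows "\<forall>a\<in>#M. a < x - \<eta>"
    and "\<eta> * poly (pderiv (pderiv (root_poly M))) (x - \<eta>) \<le> poly (pderiv (root_poly M)) (x - \<eta>)"
proof -
  show less: "\<forall>a\<in>#M. a < x - \<eta>"
  proof
    fix a assume "a \<in># M"
    then obtain N where N: "M = add_mset a N"
      by (meson multi_member_split)
    with M have "N \<noteq> {#}" "\<forall>b\<in>#N. b < x" "a < x" by auto
    \<comment> \<open>Strictness comes from the other roots, which exist because
      \<open>size M\<close> is at least 2.\<close>
    then have "\<eta> * (1 / (x - a)) < \<eta> * rsum M x"
      using rsum_pos[of N x] \<eta> by (simp add: N distrib_left)
    also have "\<dots> \<le> 1" by (rule \<eta>)
    finally show "a < x - \<eta>"
      using \<open>a < x\<close> by (simp add: field_simps)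
  qed
  define s where "s = x - \<eta>"
  have less': "\<forall>a\<in>#M. a < s" using less by (simp add: s_def)
  \<comment> \<open>Cauchy-Schwarz is split into one square per root with a free parameter
    \<open>S\<close>, which makes induction possible; \<open>S\<close> is set to the full sum only
    afterwards.\<close>
  have aux: "2 * S * (\<eta> * rsum M s) - S\<^sup>2 * (\<eta> * rsum M x) \<le> \<eta> * rsum M s + (\<Sum>a\<in>#M. (\<eta> / (s - a))\<^sup>2)"
    for S :: real
    using less'
  proof (induction M)
    case (add a M)
    define X where "X = \<eta> / (s - a)"
    have X: "X > 0" using add.prems \<eta> by (simp add: X_def)
    have "0 \<le> X / (1 + X) * (S - (1 + X))\<^sup>2"
      using X by simp
    also have "\<dots> = S\<^sup>2 * (X / (1 + X)) - 2 * S * X + X * (1 + X)"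
      using X by (simp add: field_simps power2_eq_square)
    finally have "2 * S * X - S\<^sup>2 * (X / (1 + X)) \<le> X + X\<^sup>2"
      by (simp add: power2_eq_square algebra_simps)
    moreover have "X / (1 + X) = \<eta> / (x - a)"
    proof -
      define u where "u = s - a"
      have "u > 0" "x - a = u + \<eta>" using add.prems by (simp_all add: u_def s_def)
      then show ?thesis
        using \<eta> by (simp add: X_def field_simps flip: u_def)
    qed
    ultimately have "2 * S * X - S\<^sup>2 * (\<eta> / (x - a)) \<le> X + X\<^sup>2"
      by simp
    with add show ?case
      by (simp add: algebra_simps X_def)
  qed auto
  define S where "S = \<eta> * rsum M s"
  have "S\<^sup>2 * (\<eta> * rsum M x) \<le> S\<^sup>2 * 1"
    using \<eta> by (intro mult_left_mono) auto
  with aux[of S] have "S\<^sup>2 \<le> S + (\<Sum>a\<in>#M. (\<eta> / (s - a))\<^sup>2)"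
    by (simp add: S_def power2_eq_square)
  also have "(\<Sum>a\<in>#M. (\<eta> / (s - a))\<^sup>2) = \<eta>\<^sup>2 * (\<Sum>a\<in>#M. (1 / (s - a))\<^sup>2)"
    by (simp add: sum_mset_distrib_left power_divide)
  finally have "\<eta> * (\<eta> * ((rsum M s)\<^sup>2 - (\<Sum>a\<in>#M. (1 / (s - a))\<^sup>2))) \<le> \<eta> * rsum M s"
    by (simp add: S_def power2_eq_square algebra_simps)
  then have "\<eta> * ((rsum M s)\<^sup>2 - (\<Sum>a\<in>#M. (1 / (s - a))\<^sup>2)) \<le> rsum M s"
    using \<eta> by simp
  then have "poly (root_poly M) s * (\<eta> * ((rsum M s)\<^sup>2 - (\<Sum>a\<in>#M. (1 / (s - a))\<^sup>2)))
      \<le> poly (root_poly M) s * rsum M s"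
    using poly_root_poly_pos[OF less'] by simp
  moreover have "s \<notin># M" using less' by auto
  ultimately show "\<eta> * poly (pderiv (pderiv (root_poly M))) (x - \<eta>) \<le> poly (pderiv (root_poly M)) (x - \<eta>)"
    unfolding s_def[symmetric]
    by (simp add: poly_pderiv_root_poly poly_pderiv2_root_poly mult.left_commute)
qed

section \<open>Real polynomials viewed over the complex numbers\<close>

lemma map_poly_of_real_mult:
  "map_poly of_real (p * q) = map_poly of_real p * (map_poly of_real q :: complex poly)"
  by (intro poly_eqI) (simp add: coeff_map_poly coeff_mult)

lemma map_poly_of_real_inject:
  "map_poly of_real p = (map_poly of_real q :: complex poly) \<longleftrightarrow> p = q"
  by (auto simp: poly_eq_iff coeff_map_poly)

lemma map_poly_of_real_root_poly:
  "map_poly of_real (root_poly M) = (root_poly (image_mset of_real M) :: complex poly)"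
  by (induction M) (simp_all add: map_poly_of_real_mult map_poly_pCons del: mult_pCons_left)

text \<open>The complex roots are nonnegative reals, hence fixed by
  \<open>complex_of_real \<circ> Re\<close>, so the complex factorization descends to the
  reals.\<close>

lemma monic_nonneg_real_rooted_factorization:
  assumes "lead_coeff p = 1" "only_nonneg_real_roots p"
  obtains M where "p = root_poly M" "\<forall>a\<in>#M. a \<ge> 0"
proof -
  define P where "P = map_poly complex_of_real p"
  have P: "lead_coeff P = 1"
    using assms(1) by (simp add: P_def degree_map_poly coeff_map_poly)
  then have "P \<noteq> 0" by auto
  have roots: "z \<in> \<real>\<^sub>\<ge>\<^sub>0" if "z \<in># proots P" for z
    using that assms(2) \<open>P \<noteq> 0\<close> by (auto simp: only_nonneg_real_roots_def P_def)
  have "image_mset (complex_of_real \<circ> Re) (proots P) = image_mset id (proots P)"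
    by (intro image_mset_cong) (auto dest: roots elim!: nonneg_Reals_cases)
  then have "image_mset complex_of_real (image_mset Re (proots P)) = proots P"
    by (simp add: multiset.map_comp)
  moreover have "root_poly (proots P) = P"
    using complex_poly_decompose_multiset[of P] P by (simp add: root_poly_def)
  ultimately have "P = map_poly of_real (root_poly (image_mset Re (proots P)))"
    by (simp only: map_poly_of_real_root_poly)
  then have "p = root_poly (image_mset Re (proots P))"
    by (simp add: P_def map_poly_of_real_inject)
  moreover have "\<forall>a\<in>#image_mset Re (proots P). a \<ge> 0"
    using roots by (auto simp: complex_nonneg_Reals_iff)
  ultimately show ?thesis by (rule that)
qed

lemma map_poly_of_real_pderiv:
  "map_poly complex_of_real (pderiv p) = pderiv (map_poly complex_of_real p)"
  by (intro poly_eqI) (simp add: coeff_map_poly coeff_pderiv)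

text \<open>Nothing can cancel: off the real axis all summands have imaginary part of the sign
  opposite to Im z, and on the negative axis all are negative.\<close>

lemma rsum_neq_0:
  assumes "\<forall>a\<in>#M. a \<ge> 0" "M \<noteq> {#}" "z \<notin> \<real>\<^sub>\<ge>\<^sub>0"
  shows "rsum (image_mset of_real M) z \<noteq> (0 :: complex)"
proof (cases "Im z = 0")
  case True
  then obtain x where x: "z = of_real x" by (metis complex_is_Real_iff Reals_cases)
  with assms(3) have "x < 0" by auto
  have "rsum (image_mset of_real M) z = complex_of_real (rsum M x)"
    by (induction M) (auto simp: x)
  moreover have "rsum M x < 0"
    using assms(1,2)
  proof (induction M)
    case (add a M)
    have "1 / (x - a) < 0" using add.prems \<open>x < 0\<close> by auto
    moreover have "rsum M x \<le> 0" using add by (cases "M = {#}") auto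
    ultimately show ?case unfolding rsum_add by linarith
  qed auto
  ultimately show ?thesis by simp
next
  case False
  define c where "c = (\<Sum>a\<in>#M. 1 / (norm (z - of_real a))\<^sup>2)"
  have ne: "z \<noteq> of_real a" for a using False by auto
  have "Im (rsum (image_mset of_real M) z) = - Im z * c"
    unfolding c_def
    by (induction M) (auto simp: Im_divide cmod_power2 algebra_simps)
  moreover have "c > 0"
    unfolding c_def using \<open>M \<noteq> {#}\<close>
  proof (induction M)
    case (add a M)
    have "1 / (norm (z - of_real a))\<^sup>2 > 0" using ne[of a] by simp
    then show ?case using add by (cases "M = {#}") (auto intro: add_pos_pos)
  qed auto
  ultimately show ?thesis using False by auto
qed

text \<open>A Gauss-Lucas argument: off the nonnegative axis neither f nor f' / f vanishes. Over the
  complex numbers no multiplicities need to be counted, as they would with Rolle's theorem.\<close>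

lemma pderiv_root_poly_nonneg:
  assumes "\<forall>a\<in>#M. a \<ge> 0" "M \<noteq> {#}"
  obtains M' where "pderiv (root_poly M) = smult (real (size M)) (root_poly M')"
    "\<forall>a\<in>#M'. a \<ge> 0" "size M' = size M - 1"
proof -
  define n where "n = real (size M)"
  have n: "n > 0" using assms(2) by (simp add: n_def nonempty_has_size)
  define p where "p = smult (1 / n) (pderiv (root_poly M))"
  have deg: "degree (pderiv (root_poly M)) = size M - 1"
    by (simp add: degree_pderiv)
  have "lead_coeff p = 1"
    using n assms(2) unfolding p_def
    by (simp add: deg coeff_pderiv n_def Suc_diff_1 nonempty_has_size)
  moreover have "only_nonneg_real_roots p"
    unfolding only_nonneg_real_roots_def
  proof (intro allI impI)
    fix z assume "poly (map_poly complex_of_real p) z = 0"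
    moreover have "map_poly complex_of_real p
        = smult (of_real (1 / n)) (pderiv (root_poly (image_mset of_real M)))"
      unfolding map_poly_of_real_root_poly[symmetric] map_poly_of_real_pderiv[symmetric] p_def
      by (intro poly_eqI) (simp add: coeff_map_poly)
    ultimately have 0: "poly (pderiv (root_poly (image_mset of_real M))) z = 0"
      using n by simp
    show "z \<in> \<real>\<^sub>\<ge>\<^sub>0"
    proof (rule ccontr)
      assume z: "z \<notin> \<real>\<^sub>\<ge>\<^sub>0"
      then have "z \<notin># image_mset of_real M" using assms(1) by auto
      with 0 show False
        using rsum_neq_0[OF assms z]
        by (simp add: poly_pderiv_root_poly poly_root_poly_eq_0_iff del: set_image_mset)
    qed
  qed
  ultimately obtain M' where M': "p = root_poly M'" "\<forall>a\<in>#M'. a \<ge> 0"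
    by (rule monic_nonneg_real_rooted_factorization)
  have eq: "pderiv (root_poly M) = smult n (root_poly M')"
    using n by (simp add: M'(1)[symmetric] p_def)
  then have "size M' = size M - 1"
    using deg n by (metis degree_root_poly degree_smult_eq less_irrefl)
  with eq M'(2) show ?thesis by (intro that) (auto simp: n_def)
qed

subsection \<open>The barrier condition under differentiation\<close>

text \<open>Positivity on the whole ray, rather than a statement about roots, makes the condition
  closed under sums and positive multiples.\<close>

definition barrier :: "real \<Rightarrow> real poly \<Rightarrow> real \<Rightarrow> bool" where
  "barrier \<alpha> p y \<longleftrightarrow> y > 0 \<and> (\<forall>x\<ge>y\<^sup>2. poly p x > 0)
     \<and> 2 * \<alpha> * y * poly (pderiv p) (y\<^sup>2) \<le> poly p (y\<^sup>2)"

lemma barrier_root_poly_iff: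
  "barrier \<alpha> (root_poly M) y \<longleftrightarrow> y > 0 \<and> (\<forall>a\<in>#M. a < y\<^sup>2) \<and> 2 * \<alpha> * y * rsum M (y\<^sup>2) \<le> 1"
proof -
  have "(\<forall>x\<ge>y\<^sup>2. poly (root_poly M) x > 0) \<longleftrightarrow> (\<forall>a\<in>#M. a < y\<^sup>2)"
  proof
    assume L: "\<forall>x\<ge>y\<^sup>2. poly (root_poly M) x > 0"
    show "\<forall>a\<in>#M. a < y\<^sup>2"
    proof (rule ballI, rule ccontr)
      fix a assume "a \<in># M" "\<not> a < y\<^sup>2"
      with L have "poly (root_poly M) a > 0" by auto
      with \<open>a \<in># M\<close> poly_root_poly_eq_0_iff[of M a] show False by simp
    qed
  next
    assume "\<forall>a\<in>#M. a < y\<^sup>2"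
    then show "\<forall>x\<ge>y\<^sup>2. poly (root_poly M) x > 0"
      by (auto intro!: poly_root_poly_pos intro: less_le_trans)
  qed
  moreover have "2 * \<alpha> * y * poly (pderiv (root_poly M)) (y\<^sup>2) \<le> poly (root_poly M) (y\<^sup>2)
      \<longleftrightarrow> 2 * \<alpha> * y * rsum M (y\<^sup>2) \<le> 1" if *: "\<forall>a\<in>#M. a < y\<^sup>2"
  proof -
    have "y\<^sup>2 \<notin># M" using * by auto
    then have eq: "2 * \<alpha> * y * poly (pderiv (root_poly M)) (y\<^sup>2)
        = poly (root_poly M) (y\<^sup>2) * (2 * \<alpha> * y * rsum M (y\<^sup>2))"
      by (simp add: poly_pderiv_root_poly)
    show ?thesis
      unfolding eq
      using mult_le_cancel_left_pos[OF poly_root_poly_pos[OF *], of "2 * \<alpha> * y * rsum M (y\<^sup>2)" 1]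
      by simp
  qed
  ultimately show ?thesis unfolding barrier_def by blast
qed

text \<open>For Q(y) = q(y^2) this is a quarter of the radial Laplacian Q'' + Q' / y in the plane.
  It sends x^n to n^2 x^(n-1), which fits the squared weights of the convolution.\<close>

definition lap :: "'a::idom poly \<Rightarrow> 'a poly" where
  "lap q = pderiv (pCons 0 (pderiv q))"

text \<open>Each of the two derivatives in \<open>lap\<close> is one use of
  \<open>pderiv_barrier\<close>: the first moves t^2 down to X = t (t - 2 \<alpha>), the second, for
  x q' with its extra root 0, moves X down to (t - 2 \<alpha>)^2. The extra root contributes 1 / X,
  and 1 / X + 1 / (2 \<alpha> t) is exactly 1 / \<eta> for the second step.\<close>

lemma lap_barrier:
  assumes \<alpha>: "\<alpha> > 0" and M: "\<forall>a\<in>#M. a \<ge> 0" "size M \<ge> 2" and bar: "barrier \<alpha> (root_poly M) t"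
  obtains N where "\<forall>a\<in>#N. a \<ge> 0" "size N = size M - 1"
    "lap (root_poly M) = smult ((real (size M))\<^sup>2) (root_poly N)" "barrier \<alpha> (root_poly N) (t - 2 * \<alpha>)"
proof -
  have ne: "M \<noteq> {#}" using M(2) by auto
  define n where "n = real (size M)"
  have n: "n > 0" using M(2) by (simp add: n_def)
  from bar have t: "t > 0" "\<forall>a\<in>#M. a < t\<^sup>2" "(2 * \<alpha> * t) * rsum M (t\<^sup>2) \<le> 1"
    by (auto simp: barrier_root_poly_iff)
  define X where "X = t\<^sup>2 - 2 * \<alpha> * t"
  have step1: "\<forall>a\<in>#M. a < X"
    "2 * \<alpha> * t * poly (pderiv (pderiv (root_poly M))) X \<le> poly (pderiv (root_poly M)) X"
    using pderiv_barrier[OF t(2) M(2) _ t(3)] \<alpha> t(1) by (auto simp: X_def)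
  obtain M' where M': "pderiv (root_poly M) = smult n (root_poly M')" "\<forall>a\<in>#M'. a \<ge> 0"
    "size M' = size M - 1"
    using pderiv_root_poly_nonneg[OF M(1) ne] unfolding n_def .
  have lessM': "\<forall>a\<in>#M'. a < X"
  proof (rule ballI, rule ccontr)
    fix a assume a: "a \<in># M'" "\<not> a < X"
    then have "\<forall>b\<in>#M. b < a" using step1(1) by auto
    from poly_pderiv_root_poly_pos[OF this ne] a(1) show False
      by (simp add: M' poly_root_poly_eq_0_iff[THEN iffD2])
  qed
  have X: "X > 0"
  proof -
    from ne obtain a where "a \<in># M" by blast
    then show ?thesis using M(1) step1(1) by force
  qed
  have "X = t * (t - 2 * \<alpha>)" by (simp add: X_def power2_eq_square algebra_simps)
  with X t(1) have t2: "t - 2 * \<alpha> > 0" by (simp add: zero_less_mult_iff)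
  have "X \<notin># M'" using lessM' by auto
  then have "n * (2 * \<alpha> * t * poly (root_poly M') X * rsum M' X) \<le> n * poly (root_poly M') X"
    using step1(2) by (simp add: M'(1) pderiv_smult poly_pderiv_root_poly mult.assoc mult.left_commute)
  then have "2 * \<alpha> * t * rsum M' X \<le> 1"
    using n poly_root_poly_pos[OF lessM'] by (simp add: mult.assoc mult.left_commute)
  then have r1: "rsum M' X \<le> 1 / (2 * \<alpha> * t)"
    using \<alpha> t(1) by (simp add: field_simps)
  define L where "L = add_mset 0 M'"
  define \<eta> where "\<eta> = 2 * \<alpha> * (t - 2 * \<alpha>)"
  have \<eta>: "\<eta> > 0" using \<alpha> t2 by (simp add: \<eta>_def)
  have "rsum L X \<le> 1 / X + 1 / (2 * \<alpha> * t)"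
    using r1 by (simp add: L_def)
  also have "\<dots> = 1 / \<eta>"
    using \<alpha> t(1) t2 unfolding \<open>X = t * (t - 2 * \<alpha>)\<close> \<eta>_def by (simp add: field_simps)
  finally have rL: "\<eta> * rsum L X \<le> 1"
    using \<eta> by (simp add: field_simps)
  have L: "\<forall>a\<in>#L. a < X" "size L \<ge> 2" "\<forall>a\<in>#L. a \<ge> 0" "L \<noteq> {#}"
    using lessM' X M(2) M'(2,3) by (auto simp: L_def)
  have X\<eta>: "X - \<eta> = (t - 2 * \<alpha>)\<^sup>2"
    by (simp add: X_def \<eta>_def power2_eq_square algebra_simps)
  note step2 = pderiv_barrier[OF L(1,2) \<eta> rL, unfolded X\<eta>]
  obtain N where N: "pderiv (root_poly L) = smult n (root_poly N)" "\<forall>a\<in>#N. a \<ge> 0" "size N = size M - 1"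
    using pderiv_root_poly_nonneg[OF L(3,4)] M'(3) M(2) by (auto simp: L_def n_def)
  have "lap (root_poly M) = pderiv (smult n (root_poly L))"
    by (simp add: lap_def M'(1) L_def)
  also have "\<dots> = smult (n\<^sup>2) (root_poly N)"
    by (simp add: pderiv_smult N(1) power2_eq_square)
  finally have lap: "lap (root_poly M) = smult (n\<^sup>2) (root_poly N)" .
  have "barrier \<alpha> (root_poly N) (t - 2 * \<alpha>)"
    unfolding barrier_def
  proof (intro conjI allI impI)
    fix x assume "(t - 2 * \<alpha>)\<^sup>2 \<le> x"
    then have "\<forall>a\<in>#L. a < x" using step2(1) by auto
    from poly_pderiv_root_poly_pos[OF this L(4)] n show "0 < poly (root_poly N) x"
      by (simp add: N(1) zero_less_mult_iff)
  next
    from step2(2) n show "2 * \<alpha> * (t - 2 * \<alpha>) * poly (pderiv (root_poly N)) ((t - 2 * \<alpha>)\<^sup>2)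
        \<le> poly (root_poly N) ((t - 2 * \<alpha>)\<^sup>2)"
      by (simp add: N(1) pderiv_smult \<eta>_def mult.left_commute)
  qed (use t2 in auto)
  with N lap show ?thesis by (intro that) (auto simp: n_def)
qed

subsection \<open>Algebra of the convolution\<close>

lemma smult_sum_right: "smult c (\<Sum>x\<in>A. f x) = (\<Sum>x\<in>A. smult c (f x))"
  by (induction A rule: infinite_finite_induct) (auto simp: smult_add_right)

text \<open>Indexing by the exponents a = d - i and b = d - j cancels the signs and shows the
  symmetry in \<open>p\<close> and \<open>q\<close>.\<close>

lemma asym_add_conv_altdef:
  "asym_add_conv d p q = (\<Sum>a\<le>d. \<Sum>b\<le>d. if d \<le> a + b
     then monom ((fact a * fact b / (fact d * fact (a + b - d)))\<^sup>2 * coeff p a * coeff q b) (a + b - d)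
     else 0)"
proof -
  define f where "f a b = monom ((fact a * fact b / (fact d * fact (a + b - d)))\<^sup>2
    * coeff p a * coeff q b) (a + b - d)" for a b
  have "asym_add_conv d p q = (\<Sum>k\<le>d. \<Sum>i\<le>k. f (d - i) (d - (k - i)))"
    unfolding asym_add_conv_def
  proof (intro sum.cong refl)
    fix k assume k: "k \<in> {..d}"
    have "monom ((-1) ^ k * ((fact (d - i) * fact (d - (k - i)) / (fact d * fact (d - k)))\<^sup>2
        * signed_coeff d p i * signed_coeff d q (k - i))) (d - k) = f (d - i) (d - (k - i))"
      if i: "i \<in> {..k}" for i
    proof -
      have "(-1 :: real) ^ k * ((-1) ^ i * (-1) ^ (k - i)) = 1"
        using i by (simp flip: power_add)
      moreover have "d - i + (d - (k - i)) - d = d - k" using i k by auto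
      ultimately show ?thesis
        by (simp add: f_def signed_coeff_def mult_ac)
    qed
    then show "monom ((-1) ^ k * (\<Sum>i\<le>k. (fact (d - i) * fact (d - (k - i)) / (fact d * fact (d - k)))\<^sup>2
        * signed_coeff d p i * signed_coeff d q (k - i))) (d - k) = (\<Sum>i\<le>k. f (d - i) (d - (k - i)))"
      by (simp add: sum_distrib_left monom_sum)
  qed
  also have "\<dots> = (\<Sum>(k, i)\<in>(SIGMA k:{..d}. {..k}). f (d - i) (d - (k - i)))"
    by (subst sum.Sigma) auto
  also have "\<dots> = (\<Sum>(a, b)\<in>{(a, b). a \<le> d \<and> b \<le> d \<and> d \<le> a + b}. f a b)"
    by (rule sum.reindex_bij_witness[where i = "\<lambda>(a, b). (2 * d - (a + b), d - a)"
          and j = "\<lambda>(k, i). (d - i, d - (k - i))"]) auto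
  also have "\<dots> = (\<Sum>(a, b)\<in>{..d} \<times> {..d}. if d \<le> a + b then f a b else 0)"
    by (rule sum.mono_neutral_cong_left) (auto split: if_splits)
  also have "\<dots> = (\<Sum>a\<le>d. \<Sum>b\<le>d. if d \<le> a + b then f a b else 0)"
    by (simp add: sum.cartesian_product)
  finally show ?thesis by (simp only: f_def)
qed

lemma asym_add_conv_commute: "asym_add_conv d p q = asym_add_conv d q p"
  unfolding asym_add_conv_altdef by (subst sum.swap) (auto intro!: sum.cong simp: add.commute mult_ac)

lemma asym_add_conv_add_left:
  "asym_add_conv d (p + p') q = asym_add_conv d p q + asym_add_conv d p' q"
  unfolding asym_add_conv_altdef sum.distrib[symmetric]
  by (intro sum.cong refl) (simp add: add_monom algebra_simps)

lemma asym_add_conv_smult_left: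
  "asym_add_conv d (smult c p) q = smult c (asym_add_conv d p q)"
  unfolding asym_add_conv_altdef smult_sum_right
  by (intro sum.cong refl) (simp add: smult_monom algebra_simps)

lemma asym_add_conv_smult_right:
  "asym_add_conv d p (smult c q) = smult c (asym_add_conv d p q)"
  using asym_add_conv_smult_left[of d c q p] by (simp add: asym_add_conv_commute)

lemma coeff_lap: "coeff (lap q) n = of_nat (Suc n) ^ 2 * coeff q (Suc n)"
  by (simp add: lap_def coeff_pderiv power2_eq_square mult.assoc)

text \<open>Without a term of degree d + 1 in \<open>p\<close>, only positive exponents b + 1 of
  \<open>q\<close> contribute. Their weights are those for b in degree d times ((b + 1) / (d +
  1))^2, and the numerator is supplied by \<open>lap\<close>.\<close>

lemma asym_add_conv_Suc:
  assumes "degree p \<le> d"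
  shows "asym_add_conv (Suc d) p q = smult (1 / (real (Suc d))\<^sup>2) (asym_add_conv d p (lap q))"
proof -
  define F where "F a b = (if Suc d \<le> a + b
     then monom ((fact a * fact b / (fact (Suc d) * fact (a + b - Suc d)))\<^sup>2 * coeff p a * coeff q b) (a + b - Suc d)
     else 0)" for a b
  have 0: "F (Suc d) b = 0" for b using assms by (simp add: F_def coeff_eq_0)
  have *: "F a (Suc b) = smult (1 / (real (Suc d))\<^sup>2) (if d \<le> a + b
     then monom ((fact a * fact b / (fact d * fact (a + b - d)))\<^sup>2 * coeff p a * coeff (lap q) b) (a + b - d)
     else 0)" for a b
    by (simp add: F_def smult_monom coeff_lap power_mult_distrib power_divide mult_ac del: of_nat_Suc)
  have "asym_add_conv (Suc d) p q = (\<Sum>a\<le>d. \<Sum>b\<le>Suc d. F a b)"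
    by (simp add: asym_add_conv_altdef F_def[symmetric] 0)
  also have "\<dots> = (\<Sum>a\<le>d. \<Sum>b\<le>d. F a (Suc b))"
  proof (rule sum.cong)
    fix a assume "a \<in> {..d}"
    then have "F a 0 = 0" by (simp add: F_def)
    then show "(\<Sum>b\<le>Suc d. F a b) = (\<Sum>b\<le>d. F a (Suc b))"
      by (simp add: sum.atMost_Suc_shift del: sum.atMost_Suc)
  qed simp
  finally show ?thesis
    by (simp only: asym_add_conv_altdef smult_sum_right *)
qed

subsection \<open>Convolution of two powers of linear factors\<close>

context
  fixes l m :: "'a::comm_ring_1" and x :: 'a
begin

text \<open>These are the summands of the convolution of \<open>(x + l)\<^sup>d\<close> and \<open>(x + m)\<^sup>d\<close>, the sign being
  absorbed into \<open>l\<close> and \<open>m\<close>.\<close>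

definition narayana_term :: "nat \<Rightarrow> nat \<Rightarrow> nat \<Rightarrow> 'a" where
  "narayana_term d i j = (if i + j \<le> d
     then of_nat ((d - j choose i) * (d - i choose j)) * l ^ i * m ^ j * x ^ (d - i - j) else 0)"

text \<open>Pascal's rule writes the two binomials as A + A' and B + B'; the four terms are the
  expansion (A + A')(B + B') = A B + A' (B + B') + (A + A') B' - A' B'. The extra cases are the
  boundary of the triangle i + j \<le> d.\<close>

lemma narayana_term_rec:
  "narayana_term (Suc (Suc d)) i j = x * narayana_term (Suc d) i j
     + (case i of 0 \<Rightarrow> 0 | Suc i' \<Rightarrow> l * narayana_term (Suc d) i' j)
     + (case j of 0 \<Rightarrow> 0 | Suc j' \<Rightarrow> m * narayana_term (Suc d) i j')
     - (case i of 0 \<Rightarrow> 0 | Suc i' \<Rightarrow> case j of 0 \<Rightarrow> 0 | Suc j' \<Rightarrow> l * m * narayana_term d i' j')"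
proof -
  consider "i + j \<le> Suc d" | "i + j = Suc (Suc d)" | "i + j > Suc (Suc d)" by linarith
  then show ?thesis
  proof cases
    case 1
    then obtain n where n: "Suc d = i + j + n" by (metis le_iff_add)
    show ?thesis
    proof (cases i)
      case 0
      then show ?thesis using n
        by (cases j) (auto simp: narayana_term_def algebra_simps)
    next
      case (Suc i')
      show ?thesis
      proof (cases j)
        case 0
        with Suc n have d: "d = i' + n" by simp
        show ?thesis
          by (simp add: narayana_term_def Suc 0 d algebra_simps)
      next
        case (Suc j')
        with \<open>i = Suc i'\<close> n have d: "d = Suc (i' + j' + n)" by simp
        show ?thesis
          by (simp add: narayana_term_def Suc \<open>i = Suc i'\<close> d algebra_simps)
      qed
    qed
  next
    case 2
    then show ?thesis
      by (cases i; cases j) (auto simp: narayana_term_def algebra_simps)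
  next
    case 3
    then show ?thesis
      by (cases i; cases j) (auto simp: narayana_term_def)
  qed
qed

definition narayana_sum :: "nat \<Rightarrow> 'a" where
  "narayana_sum d = (\<Sum>i\<le>d. \<Sum>j\<le>d. narayana_term d i j)"

lemma narayana_sum_eq:
  assumes "N \<ge> d"
  shows "(\<Sum>i\<le>N. \<Sum>j\<le>N. narayana_term d i j) = narayana_sum d"
  unfolding narayana_sum_def using assms
  by (intro sum.mono_neutral_cong_right ballI sum.neutral) (auto simp: narayana_term_def)

text \<open>With \<open>narayana_sum_0_1\<close> this is the recurrence of Chebyshev polynomials of
  the second kind, rescaled by the square root of l m.\<close>

lemma narayana_sum_rec:
  "narayana_sum (Suc (Suc d)) = (x + l + m) * narayana_sum (Suc d) - l * m * narayana_sum d"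
proof -
  define N where "N = Suc d"
  have N: "N \<ge> d" "N \<ge> Suc d" "Suc N \<ge> Suc d" by (auto simp: N_def)
  have z: "narayana_term (Suc d) (Suc N) j = 0" "narayana_term (Suc d) j (Suc N) = 0" for j
    by (auto simp: N_def narayana_term_def)
  have "(\<Sum>i\<le>Suc N. \<Sum>j\<le>Suc N. case i of 0 \<Rightarrow> 0 | Suc i' \<Rightarrow> l * narayana_term (Suc d) i' j)
      = l * narayana_sum (Suc d)"
    by (subst sum.atMost_Suc_shift)
      (simp add: z sum_distrib_left[symmetric] narayana_sum_eq[OF N(2)])
  moreover have "(\<Sum>i\<le>Suc N. \<Sum>j\<le>Suc N. case j of 0 \<Rightarrow> 0 | Suc j' \<Rightarrow> m * narayana_term (Suc d) i j')
      = m * narayana_sum (Suc d)"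
  proof -
    have "(\<Sum>j\<le>Suc N. case j of 0 \<Rightarrow> 0 | Suc j' \<Rightarrow> m * narayana_term (Suc d) i j')
        = m * (\<Sum>j\<le>N. narayana_term (Suc d) i j)" for i
      by (subst sum.atMost_Suc_shift) (simp add: sum_distrib_left)
    then show ?thesis
      by (simp add: z sum_distrib_left[symmetric] narayana_sum_eq[OF N(2)])
  qed
  moreover have "(\<Sum>i\<le>Suc N. \<Sum>j\<le>Suc N. case i of 0 \<Rightarrow> 0 | Suc i' \<Rightarrow>
      case j of 0 \<Rightarrow> 0 | Suc j' \<Rightarrow> l * m * narayana_term d i' j') = l * m * narayana_sum d"
    by (simp add: sum.atMost_Suc_shift narayana_sum_eq[OF N(1), symmetric] sum_distrib_left
        del: sum.atMost_Suc)
  moreover have "narayana_sum (Suc (Suc d)) = (\<Sum>i\<le>Suc N. \<Sum>j\<le>Suc N. narayana_term (Suc (Suc d)) i j)"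
    by (simp add: N_def narayana_sum_def)
  ultimately show ?thesis
    unfolding narayana_term_rec sum.distrib sum_subtractf
    by (simp add: sum_distrib_left[symmetric] narayana_sum_eq[OF N(3)] distrib_right del: sum.atMost_Suc)
qed

lemma narayana_sum_0_1: "narayana_sum 0 = 1" "narayana_sum (Suc 0) = x + l + m"
  by (simp_all add: narayana_sum_def narayana_term_def)

end


text \<open>\<open>chain_sum A B d\<close> is \<open>\<Sum>k\<le>d. A\<^sup>k B\<^sup>d\<^sup>-\<^sup>k\<close> and \<open>weighted_chain_sum A B d\<close> is
  \<open>\<Sum>k\<le>d. (d - k) A\<^sup>k B\<^sup>d\<^sup>-\<^sup>k\<close>.\<close>

fun chain_sum :: "real \<Rightarrow> real \<Rightarrow> nat \<Rightarrow> real" where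
  "chain_sum A B 0 = 1"
| "chain_sum A B (Suc d) = B * chain_sum A B d + A ^ Suc d"

fun weighted_chain_sum :: "real \<Rightarrow> real \<Rightarrow> nat \<Rightarrow> real" where
  "weighted_chain_sum A B 0 = 0"
| "weighted_chain_sum A B (Suc d) = B * (weighted_chain_sum A B d + chain_sum A B d)"

lemma chain_sum_pos: "A > 0 \<Longrightarrow> B \<ge> 0 \<Longrightarrow> chain_sum A B d > 0"
  by (induction d) (auto intro: add_nonneg_pos)

lemma weighted_chain_sum_nonneg: "A > 0 \<Longrightarrow> B \<ge> 0 \<Longrightarrow> weighted_chain_sum A B d \<ge> 0"
  by (induction d) (auto intro!: mult_nonneg_nonneg add_nonneg_nonneg less_imp_le[OF chain_sum_pos])

lemma chain_sum_rec: "chain_sum A B (Suc (Suc d)) = (A + B) * chain_sum A B (Suc d) - A * B * chain_sum A B d"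
  by (simp add: algebra_simps)

definition power_conv :: "real \<Rightarrow> real \<Rightarrow> nat \<Rightarrow> real poly" where
  "power_conv l m d = asym_add_conv d (root_poly (replicate_mset d l)) (root_poly (replicate_mset d m))"

lemma poly_power_conv: "poly (power_conv l m d) x = narayana_sum (- l) (- m) x d"
proof -
  define f where "f a b = (if d \<le> a + b
     then ((fact a * fact b / (fact d * fact (a + b - d)))\<^sup>2 * (real (d choose a) * (- l) ^ (d - a))
       * (real (d choose b) * (- m) ^ (d - b))) * x ^ (a + b - d)
     else 0)" for a b
  have "root_poly (replicate_mset d c) = [:- c, 1:] ^ d" for c :: real
    by (simp add: root_poly_def)
  then have c: "coeff (root_poly (replicate_mset d c)) a = real (d choose a) * (- c) ^ (d - a)" for c :: real and a
    by (cases "a \<le> d") (simp_all add: coeff_linear_poly_power coeff_eq_0 degree_power_eq)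
  have "poly (power_conv l m d) x = (\<Sum>a\<le>d. \<Sum>b\<le>d. f a b)"
    unfolding power_conv_def asym_add_conv_altdef poly_sum c f_def
    by (intro sum.cong refl) (simp add: poly_monom)
  also have "\<dots> = (\<Sum>i\<le>d. \<Sum>b\<le>d. f (d - i) b)"
    by (rule sum.reindex_bij_witness[where i = "\<lambda>i. d - i" and j = "\<lambda>i. d - i"]) auto
  also have "\<dots> = (\<Sum>i\<le>d. \<Sum>j\<le>d. f (d - i) (d - j))"
    by (intro sum.cong[OF refl] sum.reindex_bij_witness[where i = "\<lambda>i. d - i" and j = "\<lambda>i. d - i"]) auto
  also have "\<dots> = (\<Sum>i\<le>d. \<Sum>j\<le>d. narayana_term (- l) (- m) x d i j)"
  proof (intro sum.cong refl)
    fix i j assume ij: "i \<in> {..d}" "j \<in> {..d}"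
    show "f (d - i) (d - j) = narayana_term (- l) (- m) x d i j"
    proof (cases "i + j \<le> d")
      case True
      then obtain n where d: "d = i + j + n" by (metis le_iff_add)
      \<comment> \<open>With n = d - i - j, the squared weight and the binomials of the two linear
        powers collapse to the binomials of \<open>narayana_term\<close>.\<close>
      have "(fact (j + n) * fact (i + n) / (fact d * fact n))\<^sup>2 * (fact d / (fact (j + n) * fact i))
          * (fact d / (fact (i + n) * fact j))
          = fact (i + n) / (fact i * fact n) * (fact (j + n) / (fact j * fact n :: real))"
        by (simp add: divide_simps power2_eq_square)
      then have "(fact (j + n) * fact (i + n) / (fact d * fact n))\<^sup>2 * real (d choose (j + n))
          * real (d choose (i + n)) = real ((i + n choose i) * (j + n choose j))"
        by (simp add: d binomial_fact)
      then show ?thesis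
        by (simp add: f_def narayana_term_def d add.commute mult_ac)
    next
      case False
      with ij show ?thesis by (auto simp: f_def narayana_term_def)
    qed
  qed
  finally show ?thesis by (simp add: narayana_sum_def)
qed

lemma power_conv_simps:
  "power_conv l m 0 = 1"
  "power_conv l m (Suc 0) = [:- l - m, 1:]"
  "power_conv l m (Suc (Suc d)) = [:- l - m, 1:] * power_conv l m (Suc d) - smult (l * m) (power_conv l m d)"
  by (rule poly_ext, simp add: poly_power_conv narayana_sum_0_1 narayana_sum_rec algebra_simps)+

text \<open>\<open>A\<close> and \<open>B\<close> are the characteristic roots of the recurrence in
  \<open>power_conv_simps\<close>.\<close>

lemma poly_power_conv_eq_chain_sum:
  assumes "A + B = x - l - m" "A * B = l * m"
  shows "poly (power_conv l m d) x = chain_sum A B d"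
proof (induction d rule: induct_nat_012)
  case (ge2 d)
  have "poly (power_conv l m (Suc (Suc d))) x
      = (x - l - m) * poly (power_conv l m (Suc d)) x - l * m * poly (power_conv l m d) x"
    unfolding power_conv_simps(3) by (simp add: algebra_simps)
  then show ?case
    by (simp only: ge2 chain_sum_rec assms)
qed (use assms in \<open>simp_all add: power_conv_simps\<close>)

text \<open>Since A + B has derivative 1 in x and A B is constant, A' = A / (A - B) and B' = - B /
  (A - B); differentiating the chain sum gives the formula. The proof goes through the recurrence
  instead, so A = B is no exception.\<close>

lemma poly_pderiv_power_conv:
  assumes "A + B = x - l - m" "A * B = l * m"
  shows "(A - B) * poly (pderiv (power_conv l m d)) x
       = real d * chain_sum A B d - 2 * weighted_chain_sum A B d"
proof (induction d rule: induct_nat_012)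
  case (ge2 d)
  have "(A - B) * poly (pderiv (power_conv l m (Suc (Suc d)))) x
      = (A - B) * poly (power_conv l m (Suc d)) x
        + (x - l - m) * ((A - B) * poly (pderiv (power_conv l m (Suc d))) x)
        - l * m * ((A - B) * poly (pderiv (power_conv l m d)) x)"
    unfolding power_conv_simps(3) pderiv_diff pderiv_mult
    by (simp add: pderiv_pCons pderiv_smult algebra_simps)
  then show ?case
    unfolding ge2 poly_power_conv_eq_chain_sum[OF assms] assms[symmetric]
    by (simp add: algebra_simps)
qed (use assms in \<open>simp_all add: power_conv_simps pderiv_pCons\<close>)

text \<open>With c = d \<alpha> the hypotheses become l \<le> (s - c)^2 - c^2 and m \<le> (t - c)^2
  - c^2. Then for x \<ge> y^2 the characteristic roots are real and satisfy A - B \<ge> 2 c y, while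
  (A - B) P' \<le> d P because the weighted chain sum is nonnegative.\<close>

lemma barrier_power_conv:
  assumes \<alpha>: "\<alpha> > 0" and d: "d \<ge> 1" and nn: "l \<ge> 0" "m \<ge> 0"
    and s: "barrier \<alpha> (root_poly (replicate_mset d l)) s"
    and t: "barrier \<alpha> (root_poly (replicate_mset d m)) t"
  shows "barrier \<alpha> (power_conv l m d) (s + t - 2 * real d * \<alpha>)"
proof -
  define c where "c = real d * \<alpha>"
  have c: "c > 0" using \<alpha> d by (simp add: c_def)
  have bound: "s \<ge> 2 * c \<and> l \<le> (s - c)\<^sup>2 - c\<^sup>2"
    if "l \<ge> 0" "barrier \<alpha> (root_poly (replicate_mset d l)) s" for l s
  proof -
    have "s > 0" "s\<^sup>2 - l > 0" "2 * \<alpha> * s * (real d / (s\<^sup>2 - l)) \<le> 1"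
      using that(2) d by (auto simp: barrier_root_poly_iff rsum_def)
    then have *: "2 * c * s \<le> s\<^sup>2 - l"
      by (simp add: c_def field_simps)
    with that(1) have "s * (2 * c) \<le> s * s" by (simp add: power2_eq_square mult.commute mult.left_commute)
    with \<open>s > 0\<close> have "2 * c \<le> s" by simp
    with * show ?thesis by (simp add: power2_eq_square algebra_simps)
  qed
  define a b where "a = s - c" and "b = t - c"
  have a: "a \<ge> c" "l \<le> a\<^sup>2 - c\<^sup>2" and b: "b \<ge> c" "m \<le> b\<^sup>2 - c\<^sup>2"
    using bound[OF nn(1) s] bound[OF nn(2) t] by (auto simp: a_def b_def)
  define y where "y = a + b"
  have y: "y > 0" using a b c by (simp add: y_def)
  have roots: "\<exists>A B. A + B = x - l - m \<and> A * B = l * m \<and> A > 0 \<and> B \<ge> 0 \<and> A - B \<ge> 2 * c * y"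
    if x: "x \<ge> y\<^sup>2" for x
  proof -
    define n where "n = x - l - m"
    have "n \<ge> (a + b)\<^sup>2 - (a\<^sup>2 - c\<^sup>2) - (b\<^sup>2 - c\<^sup>2)"
      unfolding n_def using x a b by (simp add: y_def)
    then have n: "n \<ge> 2 * (a * b + c\<^sup>2)" by (simp add: power2_eq_square algebra_simps)
    have "a * b > 0" using a b c by simp
    then have pos: "2 * (a * b + c\<^sup>2) > 0" using c by (simp add: add_pos_pos)
    have "l * m \<le> (a\<^sup>2 - c\<^sup>2) * (b\<^sup>2 - c\<^sup>2)"
      using a b nn by (intro mult_mono) auto
    moreover have "(2 * (a * b + c\<^sup>2))\<^sup>2 \<le> n\<^sup>2"
      using n pos by (intro power_mono) auto
    ultimately have "(2 * (a * b + c\<^sup>2))\<^sup>2 - 4 * ((a\<^sup>2 - c\<^sup>2) * (b\<^sup>2 - c\<^sup>2)) \<le> n\<^sup>2 - 4 * (l * m)"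
      by simp
    \<comment> \<open>In the extreme case l = a^2 - c^2, m = b^2 - c^2, x = y^2 the discriminant is
      a perfect square.\<close>
    also have "(2 * (a * b + c\<^sup>2))\<^sup>2 - 4 * ((a\<^sup>2 - c\<^sup>2) * (b\<^sup>2 - c\<^sup>2)) = (2 * c * y)\<^sup>2"
      by (simp add: y_def power2_eq_square algebra_simps)
    finally have disc: "(2 * c * y)\<^sup>2 \<le> n\<^sup>2 - 4 * (l * m)" .
    define r where "r = sqrt (n\<^sup>2 - 4 * (l * m))"
    have r: "r \<ge> 2 * c * y" unfolding r_def using disc by (rule real_le_rsqrt)
    have r2: "r\<^sup>2 = n\<^sup>2 - 4 * (l * m)"
      unfolding r_def using disc by (intro real_sqrt_pow2) (meson order_trans zero_le_power2)
    have "0 < 2 * c * y" using c y by simp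
    with r have "r > 0" by linarith
    have "r\<^sup>2 \<le> n\<^sup>2" using r2 nn by simp
    then have "r \<le> n" by (rule power2_le_imp_le) (use n pos in linarith)
    have "(n + r) / 2 * ((n - r) / 2) = (n\<^sup>2 - r\<^sup>2) / 4"
      by (simp add: power2_eq_square algebra_simps)
    then have "(n + r) / 2 * ((n - r) / 2) = l * m" by (simp add: r2)
    moreover have "(n + r) / 2 + (n - r) / 2 = x - l - m" "(n + r) / 2 - (n - r) / 2 = r"
      by (simp_all add: n_def field_simps)
    moreover have "(n + r) / 2 > 0" "(n - r) / 2 \<ge> 0"
      using \<open>r > 0\<close> \<open>r \<le> n\<close> by simp_all
    ultimately show ?thesis using r by metis
  qed
  have "barrier \<alpha> (power_conv l m d) y"
    unfolding barrier_def
  proof (intro conjI allI impI y)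
    fix x assume "y\<^sup>2 \<le> x"
    from roots[OF this] show "0 < poly (power_conv l m d) x"
      using poly_power_conv_eq_chain_sum chain_sum_pos by metis
  next
    from roots[OF order_refl] obtain A B where AB: "A + B = y\<^sup>2 - l - m" "A * B = l * m" "A > 0" "B \<ge> 0"
      "A - B \<ge> 2 * c * y" by blast
    let ?P = "poly (power_conv l m d) (y\<^sup>2)" and ?P' = "poly (pderiv (power_conv l m d)) (y\<^sup>2)"
    have P: "?P > 0"
      using poly_power_conv_eq_chain_sum[OF AB(1,2)] chain_sum_pos[OF AB(3,4)] by simp
    have le: "(A - B) * ?P' \<le> real d * ?P"
      using poly_pderiv_power_conv[OF AB(1,2)] poly_power_conv_eq_chain_sum[OF AB(1,2)]
        weighted_chain_sum_nonneg[OF AB(3,4)] by simp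
    \<comment> \<open>\<open>A - B\<close> can be replaced by its lower bound only when the
      derivative is nonnegative; otherwise the left side is negative anyway.\<close>
    have "2 * c * y * ?P' \<le> real d * ?P"
    proof (cases "?P' \<ge> 0")
      case True
      with AB(5) have "2 * c * y * ?P' \<le> (A - B) * ?P'" by (rule mult_right_mono)
      with le show ?thesis by linarith
    next
      case False
      then have "2 * c * y * ?P' \<le> 0" using c y by (simp add: mult_nonneg_nonpos)
      also have "0 \<le> real d * ?P" using P by simp
      finally show ?thesis .
    qed
    then have "real d * (2 * \<alpha> * y * ?P') \<le> real d * ?P"
      by (simp add: c_def mult_ac)
    then show "2 * \<alpha> * y * ?P' \<le> ?P"
      using d by simp
  qed
  also have "y = s + t - 2 * real d * \<alpha>" by (simp add: y_def a_def b_def c_def)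
  finally show ?thesis .
qed

subsection \<open>Reduction to powers by moving pairs of roots\<close>

lemma barrier_add:
  assumes "barrier \<alpha> p y" "barrier \<alpha> q y"
  shows "barrier \<alpha> (p + q) y"
  using assms by (auto simp: barrier_def pderiv_add distrib_left intro: add_pos_pos add_mono)

lemma barrier_smult:
  assumes "barrier \<alpha> p y" "c > 0"
  shows "barrier \<alpha> (smult c p) y"
  using assms by (auto simp: barrier_def pderiv_smult mult.left_commute[of _ c] mult_left_mono)

lemma rsum_le:
  fixes x :: real
  assumes "\<forall>a\<in>#M. a \<le> r" "r < x"
  shows "rsum M x \<le> real (size M) * (1 / (x - r))"
  using assms(1)
proof (induction M)
  case (add a M)
  then have "1 / (x - a) \<le> 1 / (x - r)" using assms(2) by (intro divide_left_mono) auto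
  with add show ?case by (simp add: add_divide_distrib)
qed auto

lemma rsum_ge:
  fixes x :: real
  assumes "\<forall>a\<in>#M. r \<le> a \<and> a < x"
  shows "rsum M x \<ge> real (size M) * (1 / (x - r))"
  using assms
proof (induction M)
  case (add a M)
  then have "1 / (x - r) \<le> 1 / (x - a)" by (intro divide_left_mono) auto
  with add show ?case by (simp add: add_divide_distrib)
qed auto

text \<open>By \<open>eq\<close>, 1 / (x - r) is the mean of the reciprocals, so the roots cannot
  all lie on one side of \<open>r\<close> unless they all equal it.\<close>

lemma exists_less_of_rsum_eq:
  fixes x :: real
  assumes M: "\<forall>a\<in>#M. a < x" and r: "r < x" and eq: "rsum M x = real (size M) * (1 / (x - r))"
    and a: "a \<in># M" "a > r"
  shows "\<exists>b\<in>#M. b < r"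
proof (rule ccontr)
  assume "\<not> ?thesis"
  then have ge: "\<forall>b\<in>#M. r \<le> b" by auto
  from a(1) obtain N where N: "M = add_mset a N" by (meson multi_member_split)
  have "rsum N x \<ge> real (size N) * (1 / (x - r))"
    using ge M N by (intro rsum_ge) auto
  moreover have "1 / (x - r) < 1 / (x - a)"
    using a r M by (intro divide_strict_left_mono) auto
  ultimately show False using eq by (simp add: N add_divide_distrib)
qed

lemma exists_greater_of_rsum_eq:
  fixes x :: real
  assumes M: "\<forall>a\<in>#M. a < x" and r: "r < x" and eq: "rsum M x = real (size M) * (1 / (x - r))"
    and a: "a \<in># M" "a < r"
  shows "\<exists>b\<in>#M. b > r"
proof (rule ccontr)
  assume "\<not> ?thesis"
  then have ge: "\<forall>b\<in>#M. b \<le> r" by auto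
  from a(1) obtain N where N: "M = add_mset a N" by (meson multi_member_split)
  have "rsum N x \<le> real (size N) * (1 / (x - r))"
    using ge N r by (intro rsum_le) auto
  moreover have "1 / (x - a) < 1 / (x - r)"
    using a r M by (intro divide_strict_left_mono) auto
  ultimately show False using eq by (simp add: N add_divide_distrib)
qed

text \<open>In the variables \<open>p = 1 / (x - a)\<close>, \<open>q = 1 / (x - b)\<close>, \<open>r = 1 / (x - \<rho>)\<close>: the two roots \<open>a\<close>, \<open>b\<close>
  are moved to \<open>\<rho>\<close> and \<open>b'\<close> without changing the sum of the reciprocals. The difference of the
  two quadratics is then linear with root \<open>\<sigma>\<close>, and \<open>1 / (x - \<sigma>)\<close> is that same sum.\<close>

lemma pinch:
  fixes a b \<rho> x :: real
  assumes "0 \<le> a" "a < \<rho>" "\<rho> < b" "b < x"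
  obtains b' \<sigma> C where "0 \<le> b'" "b' < x" "0 \<le> \<sigma>" "\<sigma> < x" "C > 0"
    "1 / (x - \<rho>) + 1 / (x - b') = 1 / (x - a) + 1 / (x - b)"
    "1 / (x - \<sigma>) = 1 / (x - a) + 1 / (x - b)"
    "[:- a, 1:] * [:- b, 1:] = [:- \<rho>, 1:] * [:- b', 1:] + smult C [:- \<sigma>, 1:]"
proof -
  define p q r where "p = 1 / (x - a)" and "q = 1 / (x - b)" and "r = 1 / (x - \<rho>)"
  have pos: "p > 0" "q > 0" "r > 0" using assms by (auto simp: p_def q_def r_def)
  have pr: "p < r" unfolding p_def r_def using assms by (intro divide_strict_left_mono) auto
  have rq: "r < q" unfolding q_def r_def using assms by (intro divide_strict_left_mono) auto
  define r' where "r' = p + q - r"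
  have r': "r' > p" "r' > 0" using rq pos by (auto simp: r'_def)
  have eqs: "a = x - 1 / p" "b = x - 1 / q" "\<rho> = x - 1 / r"
    by (simp_all add: p_def q_def r_def)
  have px: "1 / p \<le> x" using assms(1) eqs(1) by simp
  \<comment> \<open>\<open>C\<close> is the increase of the root sum, which makes the linear
    coefficients agree; that \<sigma> matches the constant terms is checked below.\<close>
  define b' \<sigma> C where "b' = x - 1 / r'" and "\<sigma> = x - 1 / (p + q)"
    and "C = 1 / p + 1 / q - 1 / r - 1 / r'"
  have "1 / r' \<le> 1 / p" using r' pos by (intro divide_left_mono) auto
  moreover have "1 / (p + q) \<le> 1 / p" using pos by (intro divide_left_mono) auto
  ultimately have nn: "0 \<le> b'" "0 \<le> \<sigma>" using px by (auto simp: b'_def \<sigma>_def)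
  have less: "b' < x" "\<sigma> < x" using r' pos by (auto simp: b'_def \<sigma>_def)
  have s: "r + r' = p + q" by (simp add: r'_def)
  \<comment> \<open>Both pairs have the same sum, but r and r' lie between p and q, so their product
    is larger. This gives C > 0.\<close>
  have "r * r' - p * q = (r - p) * (q - r)" by (simp add: r'_def algebra_simps)
  then have gt: "p * q < r * r'" using pr rq by (metis diff_gt_0_iff_gt mult_pos_pos)
  have C: "C = (p + q) * (1 / (p * q) - 1 / (r * r'))"
  proof -
    have "1 / p + 1 / q = (p + q) / (p * q)" using pos by (simp add: field_simps)
    moreover have "1 / r + 1 / r' = (r + r') / (r * r')" using pos r' by (simp add: field_simps)
    ultimately show ?thesis unfolding C_def s by (simp add: algebra_simps)
  qed
  have "1 / (r * r') < 1 / (p * q)"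
    using gt pos r' by (intro divide_strict_left_mono) auto
  with C pos have "C > 0" by simp
  have "C * (1 / (p + q)) = 1 / (p * q) - 1 / (r * r')"
    unfolding C using pos by simp
  moreover have "C * \<sigma> = C * x - C * (1 / (p + q))"
    by (simp add: \<sigma>_def right_diff_distrib)
  moreover have "C * x = x * (1 / p + 1 / q) - x * (1 / r + 1 / r')"
    by (simp add: C_def algebra_simps)
  moreover have "a * b = x\<^sup>2 - x * (1 / p + 1 / q) + 1 / (p * q)"
    unfolding eqs by (simp add: power2_eq_square algebra_simps)
  moreover have "\<rho> * b' = x\<^sup>2 - x * (1 / r + 1 / r') + 1 / (r * r')"
    unfolding eqs b'_def by (simp add: power2_eq_square algebra_simps)
  ultimately have "a * b = \<rho> * b' - C * \<sigma>"
    by linarith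
  moreover have "a + b = \<rho> + b' - C" unfolding eqs b'_def C_def by simp
  ultimately have "[:- a, 1:] * [:- b, 1:] = [:- \<rho>, 1:] * [:- b', 1:] + smult C [:- \<sigma>, 1:]"
    by (simp add: mult.commute)
  moreover have "1 / (x - \<rho>) + 1 / (x - b') = 1 / (x - a) + 1 / (x - b)"
    by (simp add: eqs b'_def s)
  moreover have "1 / (x - \<sigma>) = 1 / (x - a) + 1 / (x - b)"
    by (simp add: eqs \<sigma>_def)
  ultimately show ?thesis using that nn less \<open>C > 0\<close> by blast
qed

text \<open>Induction on the number of roots different from \<rho>, where 1 / (x - \<rho>) is the
  mean of the reciprocals. A pinch moves a root to \<rho> and preserves this mean, so \<rho> stays
  fixed; the remainder has one root fewer but the same \<open>rsum\<close>, hence still satisfies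
  the barrier and falls under \<open>lower\<close>. \<open>L\<close> stands for the convolution in
  either argument.\<close>

lemma barrier_reduce_to_power:
  fixes L :: "real poly \<Rightarrow> real poly"
  assumes L: "\<And>p q. L (p + q) = L p + L q" "\<And>c p. L (smult c p) = smult c (L p)"
    and base: "\<And>\<rho>. \<rho> \<ge> 0 \<Longrightarrow> barrier \<alpha> (root_poly (replicate_mset d \<rho>)) s
      \<Longrightarrow> barrier \<alpha> (L (root_poly (replicate_mset d \<rho>))) y"
    and lower: "\<And>N. \<forall>a\<in>#N. a \<ge> 0 \<Longrightarrow> d \<ge> 2 \<Longrightarrow> size N = d - 1 \<Longrightarrow> barrier \<alpha> (root_poly N) s
      \<Longrightarrow> barrier \<alpha> (L (root_poly N)) y"
    and M: "\<forall>a\<in>#M. a \<ge> 0" "size M = d" "d \<ge> 1" "barrier \<alpha> (root_poly M) s"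
  shows "barrier \<alpha> (L (root_poly M)) y"
proof -
  define x where "x = s\<^sup>2"
  define \<kappa> where "\<kappa> = rsum M x / real d"
  define \<rho> where "\<rho> = x - 1 / \<kappa>"
  have s: "s > 0" "2 * \<alpha> * s * rsum M x \<le> 1" and lessM: "\<forall>a\<in>#M. a < x"
    using M(4) by (auto simp: barrier_root_poly_iff x_def)
  have "rsum M x > 0" using rsum_pos[OF lessM] M(2,3) by (metis not_one_le_zero size_empty)
  then have \<kappa>: "\<kappa> > 0" using M(3) by (simp add: \<kappa>_def)
  then have \<rho>: "\<rho> < x" "1 / (x - \<rho>) = \<kappa>" by (simp_all add: \<rho>_def)
  have bar_iff: "barrier \<alpha> (root_poly N) s"
    if "\<forall>a\<in>#N. a < x" "rsum N x = real d * \<kappa>" for N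
    using that s M(3) by (simp add: barrier_root_poly_iff x_def[symmetric] \<kappa>_def)
  have "barrier \<alpha> (L (root_poly N)) y"
    if "\<forall>a\<in>#N. a \<ge> 0 \<and> a < x" "size N = d" "rsum N x = real d * \<kappa>" for N
    using that
  proof (induction "size {#a \<in># N. a \<noteq> \<rho>#}" arbitrary: N rule: less_induct)
    case less
    have eq: "rsum N x = real (size N) * (1 / (x - \<rho>))" by (simp add: less \<rho>)
    show ?case
    proof (cases "\<forall>a\<in>#N. a = \<rho>")
      case True
      then have N: "N = replicate_mset d \<rho>"
        using less(3) by (metis set_mset_subset_singletonD subsetI singleton_iff)
      have "\<rho> \<in># N" using M(3) by (simp add: N)
      then have "\<rho> \<ge> 0" using less(2) by auto
      with base bar_iff[of N] less show ?thesis by (simp add: N)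
    next
      case False
      then obtain c where c: "c \<in># N" "c \<noteq> \<rho>" by auto
      have "\<exists>a\<in>#N. a < \<rho>"
        using c exists_less_of_rsum_eq[OF _ \<rho>(1) eq] less(2) by (meson linorder_neqE)
      then obtain a where a: "a \<in># N" "a < \<rho>" by auto
      have "\<exists>b\<in>#N. b > \<rho>"
        using a exists_greater_of_rsum_eq[OF _ \<rho>(1) eq] less(2) by blast
      then obtain b where b: "b \<in># N" "b > \<rho>" by auto
      obtain N1 where N1: "N = add_mset a N1" using a by (meson multi_member_split)
      with b a have "b \<in># N1" by auto
      then obtain K where "N1 = add_mset b K" by (meson multi_member_split)
      with N1 have N: "N = add_mset a (add_mset b K)" by simp
      have ab: "0 \<le> a" "b < x" using less(2) a b by auto
      obtain b' \<sigma> C where P: "0 \<le> b'" "b' < x" "0 \<le> \<sigma>" "\<sigma> < x" "C > 0"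
        "1 / (x - \<rho>) + 1 / (x - b') = 1 / (x - a) + 1 / (x - b)"
        "1 / (x - \<sigma>) = 1 / (x - a) + 1 / (x - b)"
        "[:- a, 1:] * [:- b, 1:] = [:- \<rho>, 1:] * [:- b', 1:] + smult C [:- \<sigma>, 1:]"
        using pinch[OF ab(1) a(2) b(2) ab(2)] by metis
      define N' where "N' = add_mset \<rho> (add_mset b' K)"
      define R where "R = add_mset \<sigma> K"
      have "root_poly N = ([:- a, 1:] * [:- b, 1:]) * root_poly K"
        by (simp only: N root_poly_add mult.assoc)
      also have "\<dots> = root_poly N' + smult C (root_poly R)"
        unfolding P(8) by (simp only: N'_def R_def root_poly_add distrib_right mult.assoc mult_smult_left)
      finally have split: "L (root_poly N) = L (root_poly N') + smult C (L (root_poly R))"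
        by (simp only: L)
      have K: "\<forall>a\<in>#K. a \<ge> 0 \<and> a < x" "size K = d - 2" "d \<ge> 2" using less by (auto simp: N)
      have "\<rho> \<ge> 0" using a ab by simp
      have rs: "rsum N' x = real d * \<kappa>" "rsum R x = real d * \<kappa>"
        using less(4) P(6,7) by (simp_all add: N N'_def R_def)
      have "barrier \<alpha> (L (root_poly N')) y"
      proof (rule less(1))
        \<comment> \<open>\<open>a\<close> and \<open>b\<close> leave the count and at most
          \<open>b'\<close> enters it.\<close>
        show "size {#a \<in># N'. a \<noteq> \<rho>#} < size {#a \<in># N. a \<noteq> \<rho>#}"
          using a b by (simp add: N N'_def)
      qed (use K P rs \<open>\<rho> \<ge> 0\<close> \<rho> in \<open>auto simp: N'_def\<close>)
      moreover have "barrier \<alpha> (L (root_poly R)) y"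
      proof (rule lower)
        show "barrier \<alpha> (root_poly R) s"
          using K P rs by (intro bar_iff) (auto simp: R_def)
      qed (use K P in \<open>auto simp: R_def\<close>)
      ultimately show ?thesis
        unfolding split using P(5) by (intro barrier_add barrier_smult)
    qed
  qed
  from this[of M] show ?thesis
    using M lessM by (simp add: \<kappa>_def)
qed

text \<open>The reduction is used twice: first on the right factor with the left one a power, then
  on the left factor with the right one arbitrary.\<close>

lemma barrier_asym_add_conv:
  assumes \<alpha>: "\<alpha> > 0" and "d \<ge> 1"
    and "\<forall>a\<in>#M. a \<ge> 0" "size M = d" "barrier \<alpha> (root_poly M) s"
    and "\<forall>a\<in>#K. a \<ge> 0" "size K = d" "barrier \<alpha> (root_poly K) t"
  shows "barrier \<alpha> (asym_add_conv d (root_poly M) (root_poly K)) (s + t - 2 * real d * \<alpha>)"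
  using assms(2-)
proof (induction d arbitrary: M K s t rule: less_induct)
  case (less d)
  define conv where "conv = asym_add_conv d"
  \<comment> \<open>Stated for arbitrary \<open>K\<close>, \<open>s\<close>, \<open>t\<close>, since
    it is also used with the two factors exchanged. The shifts balance: (t - 2 \<alpha>) - 2 (d - 1)
    \<alpha> = t - 2 d \<alpha>.\<close>
  have lower: "barrier \<alpha> (conv (root_poly N) (root_poly K)) (s + t - 2 * real d * \<alpha>)"
    if N: "\<forall>a\<in>#N. a \<ge> 0" "d \<ge> 2" "size N = d - 1" "barrier \<alpha> (root_poly N) s"
      and K: "\<forall>a\<in>#K. a \<ge> 0" "size K = d" "barrier \<alpha> (root_poly K) t" for N K s t
  proof -
    have "size K \<ge> 2" using N K by simp
    then obtain K' where K': "\<forall>a\<in>#K'. a \<ge> 0" "size K' = size K - 1"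
      "lap (root_poly K) = smult ((real (size K))\<^sup>2) (root_poly K')" "barrier \<alpha> (root_poly K') (t - 2 * \<alpha>)"
      using lap_barrier[OF \<alpha> K(1) _ K(3)] by blast
    obtain e where d: "d = Suc e" using N(2) by (cases d) auto
    have "conv (root_poly N) (root_poly K) = smult (1 / (real d)\<^sup>2) (asym_add_conv e (root_poly N) (lap (root_poly K)))"
      unfolding conv_def d by (rule asym_add_conv_Suc) (simp add: N d)
    also have "\<dots> = asym_add_conv e (root_poly N) (root_poly K')"
      unfolding K'(3) K(2) using d by (simp add: asym_add_conv_smult_right del: of_nat_Suc)
    finally have eq: "conv (root_poly N) (root_poly K) = asym_add_conv e (root_poly N) (root_poly K')" .
    have "barrier \<alpha> (asym_add_conv e (root_poly N) (root_poly K')) (s + (t - 2 * \<alpha>) - 2 * real e * \<alpha>)"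
      using N K K' d by (intro less(1)) auto
    then show ?thesis
      unfolding eq by (simp add: d algebra_simps)
  qed
  have comm: "conv p q = conv q p" for p q
    unfolding conv_def by (rule asym_add_conv_commute)
  have power: "barrier \<alpha> (conv (root_poly (replicate_mset d l)) (root_poly (replicate_mset d m))) (s + t - 2 * real d * \<alpha>)"
    if "l \<ge> 0" "barrier \<alpha> (root_poly (replicate_mset d l)) s"
       "m \<ge> 0" "barrier \<alpha> (root_poly (replicate_mset d m)) t" for l m
    using barrier_power_conv[OF \<alpha> less(2)] that unfolding conv_def power_conv_def by blast
  have left: "barrier \<alpha> (conv (root_poly (replicate_mset d l)) (root_poly K)) (s + t - 2 * real d * \<alpha>)"
    if l: "l \<ge> 0" "barrier \<alpha> (root_poly (replicate_mset d l)) s" for l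
  proof (rule barrier_reduce_to_power[where d = d and s = t and L = "conv (root_poly (replicate_mset d l))"])
    fix N assume "\<forall>a\<in>#N. a \<ge> 0" "d \<ge> 2" "size N = d - 1" "barrier \<alpha> (root_poly N) t"
    then have "barrier \<alpha> (conv (root_poly N) (root_poly (replicate_mset d l))) (t + s - 2 * real d * \<alpha>)"
      using l by (intro lower) auto
    then show "barrier \<alpha> (conv (root_poly (replicate_mset d l)) (root_poly N)) (s + t - 2 * real d * \<alpha>)"
      by (simp only: comm[of "root_poly (replicate_mset d l)"] add.commute)
  next
    fix p q c
    show "conv (root_poly (replicate_mset d l)) (p + q)
        = conv (root_poly (replicate_mset d l)) p + conv (root_poly (replicate_mset d l)) q"
      by (simp only: comm[of "root_poly (replicate_mset d l)"]) (simp add: conv_def asym_add_conv_add_left)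
    show "conv (root_poly (replicate_mset d l)) (smult c p) = smult c (conv (root_poly (replicate_mset d l)) p)"
      by (simp add: conv_def asym_add_conv_smult_right)
  qed (use less l power in auto)
  have "barrier \<alpha> (conv (root_poly M) (root_poly K)) (s + t - 2 * real d * \<alpha>)"
    by (rule barrier_reduce_to_power[where d = d and s = s and L = "\<lambda>p. conv p (root_poly K)"])
      (use less left lower in \<open>auto simp: conv_def asym_add_conv_add_left asym_add_conv_smult_left\<close>)
  then show ?case by (simp add: conv_def)
qed

subsection \<open>Contractions of stable bivariate polynomials\<close>

text \<open>Inversion maps the half-plane of numbers with real part at least Re u, which contains u
  - r, into a disc with 0 on its boundary.\<close>

lemma Re_inverse_diff_ge:
  assumes "Re r \<le> 0" "Re u > 0"
  shows "Re (1 / (u - r)) \<ge> Re u * (norm (1 / (u - r)))\<^sup>2"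
proof -
  have "u \<noteq> r" using assms by auto
  then have pos: "(norm (u - r))\<^sup>2 > 0" by simp
  have "Re (1 / (u - r)) = Re (u - r) / (norm (u - r))\<^sup>2"
    by (simp add: Re_divide cmod_power2)
  also have "\<dots> \<ge> Re u / (norm (u - r))\<^sup>2"
    using assms pos by (intro divide_right_mono) auto
  finally show ?thesis by (simp add: norm_divide power_divide)
qed

text \<open>The disc condition is summed after replacing |z|^2 by its tangent 2 Re (z
  \<open>cnj w\<close>) - |w|^2 at a free point \<open>w\<close>, which keeps the bound linear in
  z.\<close>

lemma Re_rsum_ge:
  assumes "\<forall>r\<in>#R. Re r \<le> 0" "Re u > 0"
  shows "Re (rsum R u) \<ge> Re u * (2 * Re (rsum R u * cnj w) - real (size R) * (norm w)\<^sup>2)"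
  using assms(1)
proof (induction R)
  case (add r R)
  define z where "z = 1 / (u - r)"
  have "0 \<le> (norm (z - w))\<^sup>2" by simp
  also have "\<dots> = (norm z)\<^sup>2 - (2 * Re (z * cnj w) - (norm w)\<^sup>2)"
    unfolding cmod_power2 by (simp add: power2_eq_square algebra_simps)
  finally have "Re u * (2 * Re (z * cnj w) - (norm w)\<^sup>2) \<le> Re u * (norm z)\<^sup>2"
    using assms(2) by (intro mult_left_mono) auto
  also have "\<dots> \<le> Re z"
    unfolding z_def using add.prems assms(2) by (intro Re_inverse_diff_ge) auto
  finally have *: "Re u * (2 * Re (z * cnj w) - (norm w)\<^sup>2) \<le> Re z" .
  have IH: "Re u * (2 * Re (rsum R u * cnj w) - real (size R) * (norm w)\<^sup>2) \<le> Re (rsum R u)"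
    using add by auto
  have "Re u * (2 * Re (rsum (add_mset r R) u * cnj w) - real (size (add_mset r R)) * (norm w)\<^sup>2)
      = Re u * (2 * Re (z * cnj w) - (norm w)\<^sup>2)
        + Re u * (2 * Re (rsum R u * cnj w) - real (size R) * (norm w)\<^sup>2)"
    by (simp add: z_def[symmetric] algebra_simps)
  also have "\<dots> \<le> Re z + Re (rsum R u)" using * IH by simp
  finally show ?case by (simp add: z_def)
qed auto

text \<open>Nonvanishing of the polar derivative \<open>N f - (u - y) f'\<close> (Laguerre): a zero would make
  \<open>w = 1 / (u - y)\<close> the mean of the numbers \<open>1 / (u - r)\<close>, \<open>r\<close> a root of \<open>f\<close>, padded by zeros. These
  lie in the disc \<open>Re w \<ge> Re u \<bar>w\<bar>\<^sup>2\<close>, and so would \<open>w\<close>, i.e. \<open>Re y \<le> 0\<close>.\<close>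

lemma polar_derivative_neq_0:
  fixes f :: "nat \<Rightarrow> complex"
  assumes nz: "\<And>u. Re u > 0 \<Longrightarrow> (\<Sum>a\<le>Suc n. f a * u ^ a) \<noteq> 0" and u: "Re u > 0" and y: "Re y > 0"
  shows "(\<Sum>a\<le>n. (of_nat (Suc n - a) * f a + of_nat (Suc a) * y * f (Suc a)) * u ^ a) \<noteq> 0"
proof
  assume zero: "(\<Sum>a\<le>n. (of_nat (Suc n - a) * f a + of_nat (Suc a) * y * f (Suc a)) * u ^ a) = 0"
  define p where "p = (\<Sum>a\<le>Suc n. monom (f a) a)"
  define R where "R = proots p"
  have poly_p: "poly p x = (\<Sum>a\<le>Suc n. f a * x ^ a)" for x
    by (simp only: p_def poly_sum poly_monom)
  have pu: "poly p u \<noteq> 0" using nz[OF u] by (simp only: poly_p not_False_eq_True)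
  then have "p \<noteq> 0" by auto
  then have p: "p = smult (lead_coeff p) (root_poly R)" "lead_coeff p \<noteq> 0"
    using complex_poly_decompose_multiset[of p] by (simp_all add: R_def root_poly_def)
  have R: "\<forall>r\<in>#R. Re r \<le> 0"
    using nz \<open>p \<noteq> 0\<close> by (force simp: R_def poly_p simp del: sum.atMost_Suc)
  have "degree p \<le> Suc n"
    unfolding p_def by (intro degree_sum_le) (auto intro: order_trans[OF degree_monom_le])
  then have size: "size R \<le> Suc n" by (simp add: R_def size_proots_complex)
  have uR: "u \<notin># R" using R u by auto
  have dp: "poly (pderiv p) u = poly p u * rsum R u"
    by (subst (1 2) p(1)) (simp add: pderiv_smult poly_pderiv_root_poly[OF uR])
  have dsum: "poly (pderiv p) u = (\<Sum>a\<le>n. of_nat (Suc a) * f (Suc a) * u ^ a)"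
  proof -
    have "coeff p a = (if a \<le> Suc n then f a else 0)" for a
      unfolding p_def coeff_sum coeff_monom by (subst sum.delta) auto
    then have "pderiv p = (\<Sum>a\<le>n. monom (of_nat (Suc a) * f (Suc a)) a)"
      by (intro poly_eqI) (simp add: coeff_pderiv coeff_sum)
    then show ?thesis by (simp add: poly_sum poly_monom)
  qed
  have usum: "u * poly (pderiv p) u = (\<Sum>a\<le>Suc n. of_nat a * f a * u ^ a)"
    unfolding dsum by (subst sum.atMost_Suc_shift) (simp add: sum_distrib_left algebra_simps)
  have "(\<Sum>a\<le>n. of_nat (Suc n - a) * f a * u ^ a) = (\<Sum>a\<le>Suc n. of_nat (Suc n - a) * f a * u ^ a)"
    by simp
  also have "\<dots> = (\<Sum>a\<le>Suc n. of_nat (Suc n) * (f a * u ^ a) - of_nat a * f a * u ^ a)"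
    by (intro sum.cong refl) (simp add: of_nat_diff algebra_simps)
  also have "\<dots> = of_nat (Suc n) * poly p u - u * poly (pderiv p) u"
    by (simp only: sum_subtractf poly_p usum sum_distrib_left)
  finally have *: "(\<Sum>a\<le>n. of_nat (Suc n - a) * f a * u ^ a)
      = of_nat (Suc n) * poly p u - u * poly (pderiv p) u" .
  have "(\<Sum>a\<le>n. (of_nat (Suc n - a) * f a + of_nat (Suc a) * y * f (Suc a)) * u ^ a)
      = (\<Sum>a\<le>n. of_nat (Suc n - a) * f a * u ^ a) + y * poly (pderiv p) u"
    unfolding dsum sum_distrib_left sum.distrib[symmetric]
    by (intro sum.cong refl) (simp only: algebra_simps)
  with * zero have "of_nat (Suc n) * poly p u - u * poly (pderiv p) u + y * poly (pderiv p) u = 0"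
    by simp
  then have "poly p u * (of_nat (Suc n) - (u - y) * rsum R u) = 0"
    unfolding dp by (simp add: algebra_simps)
  then have eq: "(u - y) * rsum R u = of_nat (Suc n)" using pu by simp
  then have "u \<noteq> y" by (auto simp del: of_nat_Suc)
  define w where "w = 1 / (u - y)"
  have W: "rsum R u = of_nat (Suc n) * w"
    using eq \<open>u \<noteq> y\<close> by (simp add: w_def field_simps del: of_nat_Suc)
  have w: "(norm w)\<^sup>2 > 0" using \<open>u \<noteq> y\<close> by (simp add: w_def)
  have "Re (rsum R u * cnj w) = real (Suc n) * (norm w)\<^sup>2"
    unfolding W mult.assoc complex_norm_square[symmetric] by (simp del: of_nat_Suc)
  moreover have "Re (rsum R u) = real (Suc n) * Re w"
    unfolding W by (simp del: of_nat_Suc)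
  ultimately have "Re u * (2 * (real (Suc n) * (norm w)\<^sup>2) - real (size R) * (norm w)\<^sup>2) \<le> real (Suc n) * Re w"
    using Re_rsum_ge[OF R u, of w] by (simp only:)
  moreover have "real (size R) * (norm w)\<^sup>2 \<le> real (Suc n) * (norm w)\<^sup>2"
    using size by (intro mult_right_mono) auto
  then have "Re u * (real (Suc n) * (norm w)\<^sup>2)
      \<le> Re u * (2 * (real (Suc n) * (norm w)\<^sup>2) - real (size R) * (norm w)\<^sup>2)"
    using u by (intro mult_left_mono) auto
  ultimately have "real (Suc n) * (Re u * (norm w)\<^sup>2) \<le> real (Suc n) * Re w"
    by (simp only: mult.left_commute)
  then have "Re u * (norm w)\<^sup>2 \<le> Re w"
    by (subst (asm) mult_le_cancel_left_pos) simp_all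
  moreover have "Re w = (Re u - Re y) * (norm w)\<^sup>2"
    unfolding w_def using \<open>u \<noteq> y\<close>
    by (simp add: Re_divide norm_divide power_divide) (simp add: cmod_power2)
  ultimately have "Re y * (norm w)\<^sup>2 \<le> 0" by (simp add: left_diff_distrib)
  with y w show False by (simp add: mult_le_0_iff)
qed

text \<open>If Re b > 0, a large positive real \<open>s\<close> pushes a + s to the right and makes
  t = k / s negligible against b; the case Re a > 0 is symmetric.\<close>

lemma split_product_right_half_plane:
  fixes a b k :: complex
  assumes "Re a + Re b > 0"
  obtains s t where "s * t = k" "Re (a + s) > 0" "Re (b + t) > 0"
proof -
  have *: "\<exists>s t. s * t = k \<and> Re (a + s) > 0 \<and> Re (b + t) > 0" if b: "Re b > 0" for a b :: complex
  proof -
    define S where "S = 1 + \<bar>Re a\<bar> + norm k / Re b"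
    have S: "S > 0" "S > norm k / Re b" "Re a + S > 0"
    proof -
      have "norm k / Re b \<ge> 0" using b by simp
      then show "S > 0" "S > norm k / Re b" "Re a + S > 0" by (auto simp: S_def)
    qed
    have "- Re (k / of_real S) \<le> norm (k / of_real S)" using abs_Re_le_cmod[of "k / of_real S"] by linarith
    also have "\<dots> = norm k / S" using S by (simp add: norm_divide)
    also have "\<dots> < Re b" using S b by (simp add: field_simps)
    finally have "Re (b + k / of_real S) > 0" by simp
    moreover have "of_real S * (k / of_real S) = k" using S by simp
    ultimately show ?thesis using S by (intro exI[of _ "of_real S"] exI[of _ "k / of_real S"]) auto
  qed
  consider "Re b > 0" | "Re a > 0" using assms by linarith
  then show ?thesis
  proof cases
    case 1
    with *[of b a] that show ?thesis by blast
  next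
    case 2
    with *[of a b] obtain s t where "s * t = k" "Re (b + s) > 0" "Re (a + t) > 0" by blast
    with that[of t s] show ?thesis by (simp add: mult.commute)
  qed
qed

text \<open>Multiplied by \<epsilon>, the form is (\<epsilon> u + \<gamma>)(\<epsilon> v + \<beta>)
  minus a constant. If the conclusion failed, the centres - \<gamma> / \<epsilon> and - \<beta> /
  \<epsilon> would add up to x, and \<open>split_product_right_half_plane\<close> would give a zero
  in the right half-planes.\<close>

lemma biaffine_neq_0:
  fixes \<alpha> \<beta> \<gamma> \<epsilon> x :: complex
  assumes nz: "\<And>u v. Re u > 0 \<Longrightarrow> Re v > 0 \<Longrightarrow> \<alpha> + \<beta> * u + \<gamma> * v + \<epsilon> * u * v \<noteq> 0"
    and "\<epsilon> \<noteq> 0" "Re x > 0"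
  shows "\<beta> + \<gamma> + x * \<epsilon> \<noteq> 0"
proof
  assume "\<beta> + \<gamma> + x * \<epsilon> = 0"
  then have x: "- \<gamma> / \<epsilon> + - \<beta> / \<epsilon> = x"
    using \<open>\<epsilon> \<noteq> 0\<close> by (simp add: field_simps add_eq_0_iff)
  then have "Re (- \<gamma> / \<epsilon>) + Re (- \<beta> / \<epsilon>) > 0"
    using \<open>Re x > 0\<close> by (metis plus_complex.simps(1))
  then obtain s t where st: "s * t = (\<beta> * \<gamma> - \<alpha> * \<epsilon>) / \<epsilon>\<^sup>2" "Re (- \<gamma> / \<epsilon> + s) > 0" "Re (- \<beta> / \<epsilon> + t) > 0"
    by (rule split_product_right_half_plane)
  define u v where "u = - \<gamma> / \<epsilon> + s" and "v = - \<beta> / \<epsilon> + t"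
  have "s = u + \<gamma> / \<epsilon>" "t = v + \<beta> / \<epsilon>" by (simp_all add: u_def v_def)
  with st(1) have "(u + \<gamma> / \<epsilon>) * (v + \<beta> / \<epsilon>) * \<epsilon>\<^sup>2 = \<beta> * \<gamma> - \<alpha> * \<epsilon>"
    using \<open>\<epsilon> \<noteq> 0\<close> by simp
  moreover have "(u + \<gamma> / \<epsilon>) * (v + \<beta> / \<epsilon>) * \<epsilon>\<^sup>2 = (\<epsilon> * u + \<gamma>) * (\<epsilon> * v + \<beta>)"
    using \<open>\<epsilon> \<noteq> 0\<close> by (simp add: field_simps power2_eq_square)
  ultimately have "\<epsilon> * (\<alpha> + \<beta> * u + \<gamma> * v + \<epsilon> * u * v) = 0"
    by (simp add: algebra_simps)
  with \<open>\<epsilon> \<noteq> 0\<close> nz[of u v] st(2,3) show False by (simp add: u_def v_def)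
qed

definition bi_nonvanishing :: "nat \<Rightarrow> (nat \<Rightarrow> nat \<Rightarrow> complex) \<Rightarrow> bool" where
  "bi_nonvanishing n c \<longleftrightarrow>
     (\<forall>u v. Re u > 0 \<longrightarrow> Re v > 0 \<longrightarrow> (\<Sum>a\<le>n. \<Sum>b\<le>n. c a b * u ^ a * v ^ b) \<noteq> 0)"

definition mixed_deriv :: "(nat \<Rightarrow> nat \<Rightarrow> complex) \<Rightarrow> nat \<Rightarrow> nat \<Rightarrow> complex" where
  "mixed_deriv c a b = of_nat (Suc a) * of_nat (Suc b) * c (Suc a) (Suc b)"

text \<open>A bivariate polynomial \<open>A = \<Sum> c a b u\<^sup>a v\<^sup>b\<close> of degree at most \<open>n + 1\<close> in each variable is
  represented by its coefficients. Polarizing one factor in each variable turns it into a biaffine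
  polynomial in two new variables \<open>s\<close>, \<open>t\<close>; the contraction applies \<open>\<partial>\<^sub>s + \<partial>\<^sub>t\<close> at a point with
  \<open>s + t = x\<close>. Iterating it evaluates the finite free convolution at \<open>x\<close>.\<close>

definition contract :: "nat \<Rightarrow> complex \<Rightarrow> (nat \<Rightarrow> nat \<Rightarrow> complex) \<Rightarrow> nat \<Rightarrow> nat \<Rightarrow> complex" where
  "contract n x c a b = of_nat (Suc a) * of_nat (Suc n - b) * c (Suc a) b
     + of_nat (Suc n - a) * of_nat (Suc b) * c a (Suc b) + x * mixed_deriv c a b"

text \<open>The polar derivative in u with pole s, followed by the one in v with pole t, yields a
  biaffine form in s and t without zeros in the right half-planes.\<close>

lemma bi_nonvanishing_contract:
  assumes c: "bi_nonvanishing (Suc n) c" "bi_nonvanishing n (mixed_deriv c)" and x: "Re x > 0"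
  shows "bi_nonvanishing n (contract n x c)"
  unfolding bi_nonvanishing_def
proof (intro allI impI)
  fix u v :: complex assume u: "Re u > 0" and v: "Re v > 0"
  define \<alpha> \<beta> \<gamma> \<epsilon> where
    "\<alpha> = (\<Sum>a\<le>n. \<Sum>b\<le>n. of_nat (Suc n - a) * of_nat (Suc n - b) * c a b * u ^ a * v ^ b)" and
    "\<beta> = (\<Sum>a\<le>n. \<Sum>b\<le>n. of_nat (Suc a) * of_nat (Suc n - b) * c (Suc a) b * u ^ a * v ^ b)" and
    "\<gamma> = (\<Sum>a\<le>n. \<Sum>b\<le>n. of_nat (Suc n - a) * of_nat (Suc b) * c a (Suc b) * u ^ a * v ^ b)" and
    "\<epsilon> = (\<Sum>a\<le>n. \<Sum>b\<le>n. mixed_deriv c a b * u ^ a * v ^ b)"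
  have "\<alpha> + \<beta> * s + \<gamma> * t + \<epsilon> * s * t \<noteq> 0" if s: "Re s > 0" and t: "Re t > 0" for s t
  proof -
    define g where "g b = (\<Sum>a\<le>n. (of_nat (Suc n - a) * c a b + of_nat (Suc a) * s * c (Suc a) b) * u ^ a)" for b
    have nz: "(\<Sum>b\<le>Suc n. g b * v ^ b) \<noteq> 0" if v: "Re v > 0" for v
    proof -
      define f where "f a = (\<Sum>b\<le>Suc n. c a b * v ^ b)" for a
      have "(\<Sum>a\<le>Suc n. f a * u ^ a) \<noteq> 0" if "Re u > 0" for u
        using c(1) that v unfolding bi_nonvanishing_def f_def sum_distrib_right
        by (simp add: mult_ac del: sum.atMost_Suc)
      from polar_derivative_neq_0[where n = n and f = f, OF this u s]
      have "(\<Sum>a\<le>n. (of_nat (Suc n - a) * f a + of_nat (Suc a) * s * f (Suc a)) * u ^ a) \<noteq> 0" .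
      also have "(\<Sum>a\<le>n. (of_nat (Suc n - a) * f a + of_nat (Suc a) * s * f (Suc a)) * u ^ a)
          = (\<Sum>a\<le>n. \<Sum>b\<le>Suc n. (of_nat (Suc n - a) * c a b + of_nat (Suc a) * s * c (Suc a) b) * u ^ a * v ^ b)"
        unfolding f_def sum_distrib_left sum_distrib_right sum.distrib[symmetric]
        by (intro sum.cong refl) (simp only: algebra_simps)
      also have "\<dots> = (\<Sum>b\<le>Suc n. g b * v ^ b)"
        unfolding g_def sum_distrib_right by (rule sum.swap)
      finally show ?thesis .
    qed
    from polar_derivative_neq_0[where n = n and f = g, OF nz v t]
    have "(\<Sum>b\<le>n. (of_nat (Suc n - b) * g b + of_nat (Suc b) * t * g (Suc b)) * v ^ b) \<noteq> 0" .
    also have "(\<Sum>b\<le>n. (of_nat (Suc n - b) * g b + of_nat (Suc b) * t * g (Suc b)) * v ^ b)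
        = (\<Sum>a\<le>n. \<Sum>b\<le>n. (of_nat (Suc n - b) * ((of_nat (Suc n - a) * c a b + of_nat (Suc a) * s * c (Suc a) b) * u ^ a)
           + of_nat (Suc b) * t * ((of_nat (Suc n - a) * c a (Suc b) + of_nat (Suc a) * s * c (Suc a) (Suc b)) * u ^ a)) * v ^ b)"
      unfolding g_def sum_distrib_left sum_distrib_right sum.distrib[symmetric]
      by (rule sum.swap)
    also have "\<dots> = \<alpha> + \<beta> * s + \<gamma> * t + \<epsilon> * s * t"
      unfolding \<alpha>_def \<beta>_def \<gamma>_def \<epsilon>_def sum_distrib_left sum_distrib_right sum.distrib[symmetric] mixed_deriv_def
      by (intro sum.cong refl) (simp only: algebra_simps)
    finally show ?thesis .
  qed
  moreover have "\<epsilon> \<noteq> 0" using c(2) u v by (auto simp: bi_nonvanishing_def \<epsilon>_def)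
  ultimately have "\<beta> + \<gamma> + x * \<epsilon> \<noteq> 0" using x by (rule biaffine_neq_0)
  also have "\<beta> + \<gamma> + x * \<epsilon> = (\<Sum>a\<le>n. \<Sum>b\<le>n. contract n x c a b * u ^ a * v ^ b)"
    unfolding \<beta>_def \<gamma>_def \<epsilon>_def sum_distrib_left sum.distrib[symmetric] contract_def
    by (intro sum.cong refl) (simp only: algebra_simps)
  finally show "(\<Sum>a\<le>n. \<Sum>b\<le>n. contract n x c a b * u ^ a * v ^ b) \<noteq> 0" .
qed

text \<open>Besides \<open>A\<close> itself all derivatives \<open>\<partial>\<^sub>u\<^sup>k \<partial>\<^sub>v\<^sup>k A\<close> are required to be nonvanishing: they supply the
  hypothesis \<open>\<epsilon> \<noteq> 0\<close> of the biaffine step, which excludes that a contraction vanishes identically.\<close>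

primrec stab :: "nat \<Rightarrow> (nat \<Rightarrow> nat \<Rightarrow> complex) \<Rightarrow> bool" where
  "stab 0 c \<longleftrightarrow> bi_nonvanishing 0 c"
| "stab (Suc n) c \<longleftrightarrow> bi_nonvanishing (Suc n) c \<and> stab n (mixed_deriv c)"

lemma stab_imp_bi_nonvanishing: "stab n c \<Longrightarrow> bi_nonvanishing n c"
  by (cases n) auto

lemma mixed_deriv_contract: "mixed_deriv (contract (Suc n) x c) = contract n x (mixed_deriv c)"
  by (intro ext) (simp add: mixed_deriv_def contract_def algebra_simps)

lemma stab_contract: "stab (Suc n) c \<Longrightarrow> Re x > 0 \<Longrightarrow> stab n (contract n x c)"
proof (induction n arbitrary: c)
  case 0
  then show ?case by (auto intro: bi_nonvanishing_contract)
next
  case (Suc n)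
  then have "bi_nonvanishing (Suc n) (contract (Suc n) x c)"
    using stab_imp_bi_nonvanishing[of "Suc n" "mixed_deriv c"]
    by (intro bi_nonvanishing_contract) auto
  moreover have "stab n (contract n x (mixed_deriv c))" using Suc by auto
  ultimately show ?case by (simp add: mixed_deriv_contract)
qed

text \<open>The weight of the symmetric finite free additive convolution; the asymmetric one uses
  its square.\<close>

definition conv_weight :: "nat \<Rightarrow> nat \<Rightarrow> nat \<Rightarrow> 'a::field_char_0" where
  "conv_weight n a b = (if n \<le> a + b then fact a * fact b / (fact n * fact (a + b - n)) else 0)"

definition contract_all :: "nat \<Rightarrow> (nat \<Rightarrow> nat \<Rightarrow> complex) \<Rightarrow> complex \<Rightarrow> complex" where
  "contract_all n c x = (\<Sum>a\<le>n. \<Sum>b\<le>n. conv_weight n a b * c a b * x ^ (a + b - n))"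

text \<open>With N = n + 1, the three parts of \<open>contract\<close> reindex to the same terms
  \<open>W a b\<close>, with factors N - b, N - a and a + b - N besides a common N; these add up to
  N.\<close>

lemma contract_all_contract:
  "contract_all n (contract n x c) x = of_nat (Suc n) ^ 2 * contract_all (Suc n) c x"
proof -
  define N :: complex where "N = of_nat (Suc n)"
  define W where "W a b = conv_weight (Suc n) a b * c a b * x ^ (a + b - Suc n)" for a b
  have W0: "W 0 b = 0" "W b 0 = 0" if "b \<le> n" for b
    using that by (simp_all add: W_def conv_weight_def)
  have s1: "(\<Sum>a\<le>Suc n. \<Sum>b\<le>Suc n. N * of_nat (Suc n - b) * W a b)
      = (\<Sum>a\<le>n. \<Sum>b\<le>n. N * of_nat (Suc n - b) * W (Suc a) b)"
    by (subst sum.atMost_Suc_shift) (simp add: W0)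
  have "(\<Sum>b\<le>Suc n. N * of_nat (Suc n - a) * W a b) = (\<Sum>b\<le>n. N * of_nat (Suc n - a) * W a (Suc b))"
    if "a \<le> n" for a
    using that by (subst sum.atMost_Suc_shift) (simp add: W0)
  then have s2: "(\<Sum>a\<le>Suc n. \<Sum>b\<le>Suc n. N * of_nat (Suc n - a) * W a b)
      = (\<Sum>a\<le>n. \<Sum>b\<le>n. N * of_nat (Suc n - a) * W a (Suc b))"
    by (subst sum.atMost_Suc) (simp del: sum.atMost_Suc)
  have s3: "(\<Sum>a\<le>Suc n. \<Sum>b\<le>Suc n. N * of_nat (a + b - Suc n) * W a b)
      = (\<Sum>a\<le>n. \<Sum>b\<le>n. N * of_nat (Suc a + Suc b - Suc n) * W (Suc a) (Suc b))"
    by (simp add: W0 sum.atMost_Suc_shift del: sum.atMost_Suc)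
  have w1: "N * conv_weight (Suc n) (Suc a) b = of_nat (Suc a) * conv_weight n a b" for a b
    by (simp add: conv_weight_def N_def del: of_nat_Suc)
  have w2: "N * conv_weight (Suc n) a (Suc b) = of_nat (Suc b) * conv_weight n a b" for a b
    by (simp add: conv_weight_def N_def del: of_nat_Suc)
  have w3: "N * of_nat (Suc a + Suc b - Suc n) * conv_weight (Suc n) (Suc a) (Suc b)
      = of_nat (Suc a) * of_nat (Suc b) * conv_weight n a b" if "n \<le> a + b" for a b
  proof -
    have "Suc a + Suc b - Suc n = Suc (a + b - n)" using that by simp
    with that show ?thesis by (simp add: conv_weight_def N_def del: of_nat_Suc)
  qed
  have t1: "conv_weight n a b * (of_nat (Suc a) * of_nat (Suc n - b) * c (Suc a) b) * x ^ (a + b - n)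
      = N * of_nat (Suc n - b) * W (Suc a) b" for a b
  proof -
    have "N * of_nat (Suc n - b) * W (Suc a) b
        = (N * conv_weight (Suc n) (Suc a) b) * (of_nat (Suc n - b) * c (Suc a) b * x ^ (a + b - n))"
      by (simp only: W_def mult_ac add_Suc diff_Suc_Suc)
    then show ?thesis unfolding w1 by (simp only: mult_ac)
  qed
  have t2: "conv_weight n a b * (of_nat (Suc n - a) * of_nat (Suc b) * c a (Suc b)) * x ^ (a + b - n)
      = N * of_nat (Suc n - a) * W a (Suc b)" for a b
  proof -
    have "N * of_nat (Suc n - a) * W a (Suc b)
        = (N * conv_weight (Suc n) a (Suc b)) * (of_nat (Suc n - a) * c a (Suc b) * x ^ (a + b - n))"
      by (simp only: W_def mult_ac add_Suc_right diff_Suc_Suc)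
    then show ?thesis unfolding w2 by (simp only: mult_ac)
  qed
  have t3: "conv_weight n a b * (x * mixed_deriv c a b) * x ^ (a + b - n)
      = N * of_nat (Suc a + Suc b - Suc n) * W (Suc a) (Suc b)" for a b
  proof (cases "n \<le> a + b")
    case True
    then have e: "Suc a + Suc b - Suc n = Suc (a + b - n)" by simp
    have "N * of_nat (Suc a + Suc b - Suc n) * W (Suc a) (Suc b)
        = (N * of_nat (Suc a + Suc b - Suc n) * conv_weight (Suc n) (Suc a) (Suc b))
          * (c (Suc a) (Suc b) * x ^ (Suc a + Suc b - Suc n))"
      by (simp only: W_def mult_ac)
    also have "\<dots> = (of_nat (Suc a) * of_nat (Suc b) * conv_weight n a b)
        * (c (Suc a) (Suc b) * (x * x ^ (a + b - n)))"
      unfolding e power_Suc w3[OF True, unfolded e] ..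
    finally show ?thesis
      unfolding mixed_deriv_def by (simp only: mult_ac)
  next
    case False
    then show ?thesis by (simp add: W_def conv_weight_def)
  qed
  have "contract_all n (contract n x c) x
      = (\<Sum>a\<le>Suc n. \<Sum>b\<le>Suc n. N * of_nat (Suc n - b) * W a b)
      + (\<Sum>a\<le>Suc n. \<Sum>b\<le>Suc n. N * of_nat (Suc n - a) * W a b)
      + (\<Sum>a\<le>Suc n. \<Sum>b\<le>Suc n. N * of_nat (a + b - Suc n) * W a b)"
  proof -
    have "contract_all n (contract n x c) x
        = (\<Sum>a\<le>n. \<Sum>b\<le>n. N * of_nat (Suc n - b) * W (Suc a) b + N * of_nat (Suc n - a) * W a (Suc b)
            + N * of_nat (Suc a + Suc b - Suc n) * W (Suc a) (Suc b))"
      unfolding contract_all_def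
      by (intro sum.cong refl) (simp only: contract_def distrib_left distrib_right t1 t2 t3)
    then show ?thesis by (simp only: s1 s2 s3 sum.distrib)
  qed
  also have "\<dots> = (\<Sum>a\<le>Suc n. \<Sum>b\<le>Suc n. N\<^sup>2 * W a b)"
    unfolding sum.distrib[symmetric]
  proof (intro sum.cong refl)
    fix a b assume ab: "a \<in> {..Suc n}" "b \<in> {..Suc n}"
    show "N * of_nat (Suc n - b) * W a b + N * of_nat (Suc n - a) * W a b + N * of_nat (a + b - Suc n) * W a b
        = N\<^sup>2 * W a b"
    proof (cases "Suc n \<le> a + b")
      case True
      with ab have "(Suc n - b) + (Suc n - a) + (a + b - Suc n) = Suc n" by auto
      then have "of_nat (Suc n - b) + of_nat (Suc n - a) + of_nat (a + b - Suc n) = N"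
        unfolding N_def of_nat_add[symmetric] by (simp only:)
      moreover have "N * of_nat (Suc n - b) * W a b + N * of_nat (Suc n - a) * W a b + N * of_nat (a + b - Suc n) * W a b
          = N * (of_nat (Suc n - b) + of_nat (Suc n - a) + of_nat (a + b - Suc n)) * W a b"
        by (simp only: distrib_left distrib_right)
      ultimately show ?thesis by (simp only: power2_eq_square)
    next
      case False
      then show ?thesis by (simp add: W_def conv_weight_def)
    qed
  qed
  finally show ?thesis
    by (simp only: contract_all_def W_def N_def sum_distrib_left)
qed

text \<open>Contracting n times reduces the sum, up to nonzero factors, to a single nonzero
  constant.\<close>

lemma contract_all_neq_0: "stab n c \<Longrightarrow> Re x > 0 \<Longrightarrow> contract_all n c x \<noteq> 0"
proof (induction n arbitrary: c)
  case 0
  then have "bi_nonvanishing 0 c" by simp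
  then have "c 0 0 \<noteq> 0"
    unfolding bi_nonvanishing_def by (auto dest!: spec[of _ 1])
  then show ?case by (simp add: contract_all_def conv_weight_def)
next
  case (Suc n)
  then have "contract_all n (contract n x c) x \<noteq> 0"
    using stab_contract by blast
  then show ?case by (auto simp: contract_all_contract)
qed

subsection \<open>Real-rootedness of the convolution\<close>

text \<open>The degree is exact, so that the first n derivatives are all nonzero, as
  \<open>stab\<close> needs.\<close>

definition hurwitz :: "nat \<Rightarrow> complex poly \<Rightarrow> bool" where
  "hurwitz n f \<longleftrightarrow> degree f = n \<and> (\<forall>u. Re u > 0 \<longrightarrow> poly f u \<noteq> 0)"

text \<open>Gauss-Lucas for the half-plane: every summand of f' / f has positive real part.\<close>

lemma hurwitz_pderiv:
  assumes "hurwitz (Suc n) f"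
  shows "hurwitz n (pderiv f)"
  unfolding hurwitz_def
proof (intro conjI allI impI)
  show "degree (pderiv f) = n" using assms by (simp add: hurwitz_def degree_pderiv)
  fix u :: complex assume u: "Re u > 0"
  have "f \<noteq> 0" using assms by (auto simp: hurwitz_def)
  define R where "R = proots f"
  have f: "f = smult (lead_coeff f) (root_poly R)"
    using complex_poly_decompose_multiset[of f] by (simp add: R_def root_poly_def)
  have R: "\<forall>r\<in>#R. Re r \<le> 0"
    using assms \<open>f \<noteq> 0\<close> by (force simp: R_def hurwitz_def)
  have "size R = Suc n" using assms by (simp add: R_def size_proots_complex hurwitz_def)
  then have ne: "R \<noteq> {#}" by auto
  have *: "Re (1 / (u - r)) > 0" if "r \<in># R" for r
  proof -
    have "u \<noteq> r" using R u that by auto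
    then have "0 < Re u * (norm (1 / (u - r)))\<^sup>2" using u by simp
    also have "\<dots> \<le> Re (1 / (u - r))" using R u that by (intro Re_inverse_diff_ge) auto
    finally show ?thesis .
  qed
  have "Re (rsum R u) > 0"
    using ne *
  proof (induction R)
    case (add r R)
    then have "Re (1 / (u - r)) > 0" by auto
    moreover have "Re (rsum R u) \<ge> 0" using add by (cases "R = {#}") auto
    ultimately show ?case unfolding rsum_add plus_complex.simps by linarith
  qed auto
  moreover have "u \<notin># R" using R u by auto
  moreover have "poly f u \<noteq> 0" using assms u by (simp add: hurwitz_def)
  moreover have "poly (pderiv f) u = poly f u * rsum R u"
    by (subst (1 2) f) (simp add: pderiv_smult poly_pderiv_root_poly[OF \<open>u \<notin># R\<close>])
  ultimately show "poly (pderiv f) u \<noteq> 0" by auto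
qed

lemma poly_eq_sum:
  fixes f :: "'a::comm_semiring_1 poly"
  assumes "degree f \<le> n"
  shows "poly f u = (\<Sum>a\<le>n. coeff f a * u ^ a)"
  unfolding poly_altdef using assms by (intro sum.mono_neutral_left) (auto simp: coeff_eq_0)

lemma stab_hurwitz: "hurwitz n f \<Longrightarrow> hurwitz n g \<Longrightarrow> stab n (\<lambda>a b. coeff f a * coeff g b)"
proof (induction n arbitrary: f g)
  have non: "bi_nonvanishing n (\<lambda>a b. coeff f a * coeff g b)" if "hurwitz n f" "hurwitz n g" for n f g
    unfolding bi_nonvanishing_def
  proof (intro allI impI)
    fix u v :: complex assume "Re u > 0" "Re v > 0"
    with that have "poly f u * poly g v \<noteq> 0" by (simp add: hurwitz_def)
    also have "poly f u * poly g v = (\<Sum>a\<le>n. \<Sum>b\<le>n. coeff f a * coeff g b * u ^ a * v ^ b)"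
      using that by (simp add: hurwitz_def poly_eq_sum[of _ n] sum_product mult_ac)
    finally show "(\<Sum>a\<le>n. \<Sum>b\<le>n. coeff f a * coeff g b * u ^ a * v ^ b) \<noteq> 0" .
  qed
  {
    case 0
    then show ?case by (simp add: non)
  next
    case (Suc n)
    have "mixed_deriv (\<lambda>a b. coeff f a * coeff g b) = (\<lambda>a b. coeff (pderiv f) a * coeff (pderiv g) b)"
      by (intro ext) (simp add: mixed_deriv_def coeff_pderiv del: of_nat_Suc)
    then show ?case
      using Suc by (simp add: non hurwitz_pderiv)
  }
qed

lemma stabI:
  assumes "\<And>k. k \<le> n \<Longrightarrow> bi_nonvanishing (n - k) ((mixed_deriv ^^ k) c)"
  shows "stab n c"
  using assms
proof (induction n arbitrary: c)
  case 0
  from 0[of 0] show ?case by simp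
next
  case (Suc n)
  have "bi_nonvanishing (n - k) ((mixed_deriv ^^ k) (mixed_deriv c))" if "k \<le> n" for k
    using Suc.prems[of "Suc k"] that by (simp add: funpow_swap1)
  with Suc.IH Suc.prems[of 0] show ?case by simp
qed

lemma mixed_deriv_funpow:
  "(mixed_deriv ^^ k) c a b
     = pochhammer (of_nat (Suc a)) k * pochhammer (of_nat (Suc b)) k * c (a + k) (b + k)"
proof (induction k arbitrary: a b)
  case (Suc k)
  have "(mixed_deriv ^^ Suc k) c a b
      = of_nat (Suc a) * of_nat (Suc b) * (mixed_deriv ^^ k) c (Suc a) (Suc b)"
    by (simp add: mixed_deriv_def del: of_nat_Suc)
  also have "\<dots> = pochhammer (of_nat (Suc a)) (Suc k) * pochhammer (of_nat (Suc b)) (Suc k) * c (a + Suc k) (b + Suc k)"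
    unfolding Suc pochhammer_rec by (simp add: add.commute mult_ac)
  finally show ?case .
qed simp

lemma higher_pderiv_root_poly:
  assumes "\<forall>a\<in>#M. a \<ge> 0" "k \<le> size M"
  obtains c M' where "c \<noteq> 0" "(pderiv ^^ k) (root_poly M) = smult c (root_poly M')"
    "\<forall>a\<in>#M'. a \<ge> (0 :: real)" "size M' = size M - k"
proof -
  have "\<exists>c M'. c \<noteq> 0 \<and> (pderiv ^^ k) (root_poly M) = smult c (root_poly M')
      \<and> (\<forall>a\<in>#M'. a \<ge> 0) \<and> size M' = size M - k"
    using assms(2)
  proof (induction k)
    case 0
    then show ?case using assms(1) by (intro exI[of _ 1] exI[of _ M]) auto
  next
    case (Suc k)
    then obtain c N where N: "c \<noteq> 0" "(pderiv ^^ k) (root_poly M) = smult c (root_poly N)"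
      "\<forall>a\<in>#N. a \<ge> 0" "size N = size M - k" by auto
    from Suc.prems N(4) have "N \<noteq> {#}" by auto
    with pderiv_root_poly_nonneg[OF N(3)] obtain N' where
      "pderiv (root_poly N) = smult (real (size N)) (root_poly N')" "\<forall>a\<in>#N'. a \<ge> 0" "size N' = size N - 1"
      by blast
    with N \<open>N \<noteq> {#}\<close> show ?case
      by (intro exI[of _ "c * real (size N)"] exI[of _ N']) (auto simp: pderiv_smult)
  qed
  with that show ?thesis by blast
qed

lemma map_poly_of_real_higher_pderiv:
  "map_poly complex_of_real ((pderiv ^^ k) p) = (pderiv ^^ k) (map_poly complex_of_real p)"
  by (induction k) (simp_all add: map_poly_of_real_pderiv)

text \<open>The arguments of both factors are below a right angle in size, so the product cannot
  reach the nonpositive axis.\<close>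

lemma right_half_plane_prod_not_nonpos:
  assumes "Re u > 0" "Re z > 0"
  shows "- (u * z) \<notin> \<real>\<^sub>\<ge>\<^sub>0"
proof
  assume "- (u * z) \<in> \<real>\<^sub>\<ge>\<^sub>0"
  then obtain r where r: "u * z = - complex_of_real r" "r \<ge> 0"
    by (metis minus_minus nonneg_Reals_cases)
  have "u * of_real ((norm z)\<^sup>2) = u * z * cnj z"
    by (simp only: complex_norm_square mult.assoc)
  also have "\<dots> = - of_real r * cnj z" by (simp only: r(1))
  finally have "Re (u * of_real ((norm z)\<^sup>2)) = Re (- of_real r * cnj z)" by (rule arg_cong)
  then have "Re u * (norm z)\<^sup>2 = - (r * Re z)" by simp
  moreover have "Re u * (norm z)\<^sup>2 > 0" using assms by (intro mult_pos_pos) auto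
  moreover have "r * Re z \<ge> 0" using r assms by simp
  ultimately show False by linarith
qed

text \<open>The polynomial \<open>\<partial>\<^sub>u\<^sup>k p(- u X)\<close> in \<open>X\<close>.\<close>

definition dilated_deriv :: "real poly \<Rightarrow> nat \<Rightarrow> complex \<Rightarrow> complex poly" where
  "dilated_deriv p k u = monom ((-1) ^ k) k
     * pcompose ((pderiv ^^ k) (map_poly complex_of_real p)) [:0, - u:]"

lemma coeff_dilated_deriv:
  "coeff (dilated_deriv p k u) (a + k)
     = (-1) ^ (a + k) * pochhammer (of_nat (Suc a)) k * of_real (coeff p (a + k)) * u ^ a"
  "a < k \<Longrightarrow> coeff (dilated_deriv p k u) a = 0"
proof -
  have "(-1) ^ k * (- u) ^ a = (-1) ^ (a + k) * u ^ a"
    by (simp add: power_add power_minus[of u])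
  then show "coeff (dilated_deriv p k u) (a + k)
     = (-1) ^ (a + k) * pochhammer (of_nat (Suc a)) k * of_real (coeff p (a + k)) * u ^ a"
    by (simp add: dilated_deriv_def coeff_monom_mult coeff_pcompose_linear coeff_higher_pderiv
        coeff_map_poly mult_ac del: of_nat_Suc)
qed (simp add: dilated_deriv_def coeff_monom_mult)

text \<open>The zeros in X are 0, from the factor X^k, and numbers - r / u with r \<ge> 0, none of
  them in the right half-plane. The factor X^k restores the degree lost by differentiating.\<close>

lemma hurwitz_dilated_deriv:
  assumes M: "\<forall>a\<in>#M. a \<ge> 0" "k \<le> size M" and u: "Re u > 0"
  shows "hurwitz (size M) (dilated_deriv (root_poly M) k u)"
proof -
  obtain c N where N: "c \<noteq> 0" "(pderiv ^^ k) (root_poly M) = smult c (root_poly N)"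
    "\<forall>a\<in>#N. a \<ge> 0" "size N = size M - k"
    using higher_pderiv_root_poly[OF M] by blast
  have "(pderiv ^^ k) (map_poly complex_of_real (root_poly M)) = map_poly complex_of_real (smult c (root_poly N))"
    by (simp only: map_poly_of_real_higher_pderiv[symmetric] N(2))
  also have "\<dots> = smult (of_real c) (root_poly (image_mset of_real N))"
    unfolding map_poly_of_real_root_poly[symmetric] by (intro poly_eqI) (simp add: coeff_map_poly)
  finally have f: "dilated_deriv (root_poly M) k u = smult ((-1) ^ k * of_real c)
      (monom 1 k * pcompose (root_poly (image_mset of_real N)) [:0, - u:])"
    by (simp add: dilated_deriv_def pcompose_smult smult_monom flip: mult_smult_left)
  have "u \<noteq> 0" using u by auto
  have deg: "degree (pcompose (root_poly (image_mset complex_of_real N)) [:0, - u:]) = size M - k"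
    using \<open>u \<noteq> 0\<close> by (simp add: degree_pcompose N(4))
  have nz: "pcompose (root_poly (image_mset complex_of_real N)) [:0, - u:] \<noteq> 0"
    using \<open>u \<noteq> 0\<close> by (simp add: pcompose_eq_0_iff)
  show ?thesis
    unfolding hurwitz_def
  proof (intro conjI allI impI)
    show "degree (dilated_deriv (root_poly M) k u) = size M"
      using nz N(1) M(2) by (simp add: f degree_mult_eq deg degree_monom_eq)
    fix z :: complex assume z: "Re z > 0"
    have "- (u * z) \<notin># image_mset complex_of_real N"
    proof
      assume "- (u * z) \<in># image_mset complex_of_real N"
      then obtain x where x: "x \<in># N" "- (u * z) = complex_of_real x" by auto
      then have "- (u * z) \<in> \<real>\<^sub>\<ge>\<^sub>0"
        using N(3) by (simp only: nonneg_Reals_of_real_iff)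
      with right_half_plane_prod_not_nonpos[OF u z] show False by blast
    qed
    then have "poly (root_poly (image_mset complex_of_real N)) (- (u * z)) \<noteq> 0"
      unfolding poly_root_poly_eq_0_iff .
    moreover have "z \<noteq> 0" using z by auto
    ultimately show "poly (dilated_deriv (root_poly M) k u) z \<noteq> 0"
      using N(1) by (simp add: f poly_monom poly_pcompose mult.commute)
  qed
qed

lemma sum_atMost_shift:
  fixes h :: "nat \<Rightarrow> 'a::comm_monoid_add"
  assumes "k \<le> d" "\<And>a. a < k \<Longrightarrow> h a = 0"
  shows "(\<Sum>a\<le>d. h a) = (\<Sum>a\<le>d - k. h (a + k))"
proof -
  have "(\<Sum>a\<le>d. h a) = (\<Sum>a\<in>{k..d}. h a)"
    using assms by (intro sum.mono_neutral_right) (auto simp: not_le)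
  also have "\<dots> = (\<Sum>a\<le>d - k. h (a + k))"
    by (rule sum.reindex_bij_witness[where i = "\<lambda>a. a + k" and j = "\<lambda>a. a - k"]) (use assms in auto)
  finally show ?thesis .
qed

lemma poly_map_poly_of_real_asym_add_conv:
  "poly (map_poly complex_of_real (asym_add_conv d p q)) z
     = (\<Sum>a\<le>d. \<Sum>b\<le>d. (conv_weight d a b)\<^sup>2 * of_real (coeff p a) * of_real (coeff q b) * z ^ (a + b - d))"
proof -
  have sum: "map_poly complex_of_real (\<Sum>a\<in>A. f a) = (\<Sum>a\<in>A. map_poly complex_of_real (f a))"
    for f :: "nat \<Rightarrow> real poly" and A
    by (intro poly_eqI) (simp add: coeff_map_poly coeff_sum)
  have monom: "map_poly complex_of_real (monom c n) = monom (of_real c) n" for c n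
    by (intro poly_eqI) (simp add: coeff_map_poly)
  show ?thesis
    unfolding asym_add_conv_altdef sum poly_sum
    by (intro sum.cong refl) (simp add: monom poly_monom conv_weight_def)
qed

text \<open>The squared weight is produced by two contractions at the same point z with z^2 = - s:
  the inner one shows that the array \<open>c\<close> is stable, the outer one evaluates the
  convolution at s up to sign.\<close>

lemma only_nonneg_real_roots_asym_add_conv:
  assumes M: "\<forall>a\<in>#M. a \<ge> 0" "size M = d" and K: "\<forall>a\<in>#K. a \<ge> 0" "size K = d"
  shows "only_nonneg_real_roots (asym_add_conv d (root_poly M) (root_poly K))"
  unfolding only_nonneg_real_roots_def
proof (intro allI impI, rule ccontr)
  fix s assume zero: "poly (map_poly complex_of_real (asym_add_conv d (root_poly M) (root_poly K))) s = 0"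
    and s: "s \<notin> \<real>\<^sub>\<ge>\<^sub>0"
  \<comment> \<open>The principal root has Re z \<ge> 0, and Re z = 0 would make s a nonnegative
    real.\<close>
  define z where "z = csqrt (- s)"
  have z2: "z * z = - s" by (simp add: z_def flip: power2_eq_square)
  have "Re z \<noteq> 0"
  proof
    assume "Re z = 0"
    then have "z * z = - of_real ((Im z)\<^sup>2)"
      by (simp add: complex_eq_iff power2_eq_square)
    with z2 have "s = of_real ((Im z)\<^sup>2)" by (metis minus_equation_iff)
    with s show False by (simp only: nonneg_Reals_of_real_iff zero_le_power2 not_True_eq_False)
  qed
  moreover have "Re z \<ge> 0" using csqrt_principal[of "- s"] by (auto simp: z_def)
  ultimately have z: "Re z > 0" by simp
  define P where "P a = complex_of_real (coeff (root_poly M) a)" for a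
  define Q where "Q a = complex_of_real (coeff (root_poly K) a)" for a
  \<comment> \<open>The coefficients in u and v of the symmetric convolution of p(- u X) and q(- v
    X) at z; they carry one of the two weight factors.\<close>
  define c where "c a b = (-1) ^ (a + b) * conv_weight d a b * P a * Q b * z ^ (a + b - d)" for a b
  have "stab d c"
  proof (rule stabI)
    fix k assume k: "k \<le> d"
    show "bi_nonvanishing (d - k) ((mixed_deriv ^^ k) c)"
      unfolding bi_nonvanishing_def
    proof (intro allI impI)
      fix u v :: complex assume uv: "Re u > 0" "Re v > 0"
      \<comment> \<open>The k-th mixed derivative acts on each dilated polynomial separately, so it
        is again a contraction of two Hurwitz polynomials.\<close>
      define F where "F = dilated_deriv (root_poly M) k u"
      define G where "G = dilated_deriv (root_poly K) k v"
      have "hurwitz d F" "hurwitz d G"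
        using hurwitz_dilated_deriv[OF M(1) _ uv(1), of k] hurwitz_dilated_deriv[OF K(1) _ uv(2), of k] M(2) K(2) k
        by (auto simp: F_def G_def)
      then have "contract_all d (\<lambda>a b. coeff F a * coeff G b) z \<noteq> 0"
        using z by (intro contract_all_neq_0 stab_hurwitz)
      also have "contract_all d (\<lambda>a b. coeff F a * coeff G b) z
          = (\<Sum>a\<le>d - k. \<Sum>b\<le>d - k. conv_weight d (a + k) (b + k) * (coeff F (a + k) * coeff G (b + k))
              * z ^ (a + k + (b + k) - d))"
        unfolding contract_all_def
        by (subst sum_atMost_shift[OF k]) (simp_all add: F_def G_def coeff_dilated_deriv sum_atMost_shift[OF k])
      also have "\<dots> = (\<Sum>a\<le>d - k. \<Sum>b\<le>d - k. (mixed_deriv ^^ k) c a b * u ^ a * v ^ b)"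
        by (intro sum.cong refl)
          (simp add: mixed_deriv_funpow c_def F_def G_def coeff_dilated_deriv P_def Q_def power_add mult_ac del: of_nat_Suc)
      finally show "(\<Sum>a\<le>d - k. \<Sum>b\<le>d - k. (mixed_deriv ^^ k) c a b * u ^ a * v ^ b) \<noteq> 0" .
    qed
  qed
  then have "contract_all d c z \<noteq> 0" using z by (rule contract_all_neq_0)
  also have "contract_all d c z = (-1) ^ d * poly (map_poly complex_of_real (asym_add_conv d (root_poly M) (root_poly K))) s"
    unfolding contract_all_def poly_map_poly_of_real_asym_add_conv sum_distrib_left
  proof (intro sum.cong refl)
    fix a b
    show "conv_weight d a b * c a b * z ^ (a + b - d)
        = (-1) ^ d * ((conv_weight d a b)\<^sup>2 * of_real (coeff (root_poly M) a) * of_real (coeff (root_poly K) b) * s ^ (a + b - d))"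
    proof (cases "d \<le> a + b")
      case True
      then have "(-1) ^ (a + b) = (-1) ^ d * (-1 :: complex) ^ (a + b - d)"
        by (simp flip: power_add)
      moreover have "s = - (z * z)" by (simp add: z2)
      then have "s ^ (a + b - d) = (-1) ^ (a + b - d) * (z ^ (a + b - d) * z ^ (a + b - d))"
        by (simp add: power_minus[of "z * z"] power_mult_distrib)
      ultimately show ?thesis
        by (simp add: c_def P_def Q_def power2_eq_square mult_ac)
    next
      case False
      then show ?thesis by (simp add: conv_weight_def)
    qed
  qed
  finally show False using zero by simp
qed

lemma asym_add_conv_monic:
  assumes "coeff p d = 1" "coeff q d = 1"
  shows "degree (asym_add_conv d p q) = d" "lead_coeff (asym_add_conv d p q) = 1"
proof -
  define W where "W a b = (fact a * fact b / (fact d * fact (a + b - d)))\<^sup>2 * coeff p a * coeff q b" for a b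
  have coeff: "coeff (asym_add_conv d p q) m = (\<Sum>a\<le>d. \<Sum>b\<le>d. if d \<le> a + b \<and> a + b - d = m then W a b else 0)" for m
    unfolding asym_add_conv_altdef coeff_sum W_def by (intro sum.cong refl) simp
  have 1: "coeff (asym_add_conv d p q) d = 1"
  proof -
    have "coeff (asym_add_conv d p q) d = (\<Sum>a\<le>d. if a = d then (\<Sum>b\<le>d. if b = d then W a b else 0) else 0)"
      unfolding coeff by (intro sum.cong refl) (auto intro!: sum.neutral sum.cong)
    also have "\<dots> = W d d" by simp
    finally show ?thesis by (simp add: W_def assms)
  qed
  have "degree (asym_add_conv d p q) \<le> d"
    by (rule degree_le) (auto simp: coeff intro!: sum.neutral)
  moreover have "degree (asym_add_conv d p q) \<ge> d" using 1 by (intro le_degree) simp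
  ultimately show "degree (asym_add_conv d p q) = d" by simp
  with 1 show "lead_coeff (asym_add_conv d p q) = 1" by simp
qed

subsection \<open>The transforms and the main inequality\<close>

lemma sq_subst_mult: "sq_subst (p * q) = sq_subst p * sq_subst q"
  by (simp add: sq_subst_def pcompose_mult)

lemma poly_sq_subst: "poly (sq_subst p) x = poly p (x\<^sup>2)"
  by (simp add: sq_subst_def poly_pcompose poly_monom)

lemma sq_subst_root_poly:
  assumes "\<forall>a\<in>#M. a \<ge> 0"
  shows "sq_subst (root_poly M) = root_poly (image_mset sqrt M + image_mset (\<lambda>a. - sqrt a) M)"
  using assms
proof (induction M)
  case (add a M)
  have "sq_subst [:- a, 1:] = [:- sqrt a, 1:] * [:sqrt a, 1:]"
    using add.prems by (intro poly_ext) (simp add: poly_sq_subst power2_eq_square algebra_simps)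
  with add show ?case
    by (simp only: root_poly_add sq_subst_mult) (simp add: mult_ac del: mult_pCons_left mult_pCons_right)
qed (simp add: sq_subst_def pcompose_1)

text \<open>The roots pair up as 1 / (x - sqrt a) + 1 / (x + sqrt a) = 2 x / (x^2 - a), and the 2
  cancels against the doubled degree.\<close>

lemma cauchy_transform_sq_subst:
  assumes "\<forall>a\<in>#M. a \<ge> 0" "x\<^sup>2 \<notin># M"
  shows "cauchy_transform (sq_subst (root_poly M)) x = x * rsum M (x\<^sup>2) / real (size M)"
proof -
  have "(\<Sum>t\<in>#image_mset sqrt M + image_mset (\<lambda>a. - sqrt a) M. 1 / (x - t)) = 2 * x * rsum M (x\<^sup>2)"
    using assms
  proof (induction M)
    case (add a M)
    have "x \<noteq> sqrt a" "x \<noteq> - sqrt a" using add.prems by auto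
    then have "1 / (x - sqrt a) + 1 / (x + sqrt a) = 2 * x / ((x - sqrt a) * (x + sqrt a))"
      by (simp add: field_simps)
    also have "(x - sqrt a) * (x + sqrt a) = x\<^sup>2 - a"
      using add.prems by (simp add: power2_eq_square algebra_simps)
    finally show ?case using add by (simp add: algebra_simps)
  qed auto
  then show ?thesis
    using assms by (simp add: cauchy_transform_def sq_subst_root_poly del: image_mset_union sum_mset.union)
qed

lemma rsum_sq_strict_antimono:
  fixes x y :: real
  assumes M: "\<forall>a\<in>#M. 0 \<le> a \<and> a < x\<^sup>2" "M \<noteq> {#}" and xy: "0 < x" "x < y"
  shows "y * rsum M (y\<^sup>2) < x * rsum M (x\<^sup>2)"
  using M
proof (induction M)
  case (add a M)
  have "x\<^sup>2 < y\<^sup>2" using xy by (simp add: power_strict_mono)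
  then have pos: "x\<^sup>2 - a > 0" "y\<^sup>2 - a > 0" using add.prems by auto
  have "x * (y\<^sup>2 - a) - y * (x\<^sup>2 - a) = (y - x) * (x * y + a)"
    by (simp add: power2_eq_square algebra_simps)
  also have "\<dots> > 0" using xy add.prems by (intro mult_pos_pos add_pos_nonneg) auto
  finally have 1: "y * (1 / (y\<^sup>2 - a)) < x * (1 / (x\<^sup>2 - a))"
    using pos by (simp add: field_simps)
  have 2: "y * rsum M (y\<^sup>2) \<le> x * rsum M (x\<^sup>2)"
    using add by (cases "M = {#}") auto
  show ?case unfolding rsum_add distrib_left using 1 2 by linarith
qed auto

text \<open>Intermediate values beyond s, the root of the largest element m. The left end comes from
  the lower bound 1 / (2 (y - s)) given by m alone, the right end from the upper bound n / (y -
  s).\<close>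

lemma exists_rsum_sq_eq:
  fixes v :: real
  assumes M: "\<forall>a\<in>#M. a \<ge> 0" "M \<noteq> {#}" and v: "v > 0"
  obtains y where "y > 0" "\<forall>a\<in>#M. a < y\<^sup>2" "y * rsum M (y\<^sup>2) = v"
proof -
  define m where "m = Max (set_mset M)"
  have m: "m \<in># M" "\<forall>a\<in>#M. a \<le> m" using M by (auto simp: m_def)
  with M have "m \<ge> 0" by auto
  define s where "s = sqrt m"
  have s: "s \<ge> 0" "s\<^sup>2 = m" using \<open>m \<ge> 0\<close> by (auto simp: s_def)
  define n where "n = real (size M)"
  have n: "n \<ge> 1" using M(2) unfolding n_def by (simp add: Suc_leI nonempty_has_size)
  have gt: "\<forall>a\<in>#M. a < y\<^sup>2" if "y > s" for y
  proof -
    have "s\<^sup>2 < y\<^sup>2" using that s by (intro power_strict_mono) auto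
    with s m show ?thesis by auto
  qed
  have factor: "y\<^sup>2 - m = (y - s) * (y + s)" for y
    by (simp add: s(2)[symmetric] power2_eq_square algebra_simps)
  define y1 where "y1 = s + 1 / (2 * v)"
  define y2 where "y2 = s + n / v"
  have y1: "y1 > s" using v by (simp add: y1_def)
  have y12: "y1 \<le> y2" unfolding y1_def y2_def using n v by (simp add: field_simps)
  have "v \<le> y1 * rsum M (y1\<^sup>2)"
  proof -
    obtain N where N: "M = add_mset m N" using m by (meson multi_member_split)
    have "1 / (y1\<^sup>2 - m) \<le> rsum M (y1\<^sup>2)"
      using rsum_nonneg[of N "y1\<^sup>2"] gt[OF y1] by (simp add: N)
    then have "y1 * (1 / (y1\<^sup>2 - m)) \<le> y1 * rsum M (y1\<^sup>2)"
      using y1 s by (intro mult_left_mono) auto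
    moreover have "v \<le> y1 * (1 / (y1\<^sup>2 - m))"
    proof -
      have "v * (y1\<^sup>2 - m) = (y1 + s) / 2"
        unfolding factor using v by (simp add: y1_def)
      also have "\<dots> \<le> y1" using y1 by simp
      finally show ?thesis
        using gt[OF y1] m by (simp add: field_simps)
    qed
    ultimately show ?thesis by linarith
  qed
  moreover have "y2 * rsum M (y2\<^sup>2) \<le> v"
  proof -
    have y2: "y2 > s" using y1 y12 by simp
    then have less: "m < y2\<^sup>2" using gt m by blast
    have "y2 * rsum M (y2\<^sup>2) \<le> y2 * (n * (1 / (y2\<^sup>2 - m)))"
      unfolding n_def using y2 s m less by (intro mult_left_mono rsum_le) auto
    also have "\<dots> \<le> v"
    proof -
      have "y2 * n \<le> n * (y2 + s)" using n s by (simp add: algebra_simps)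
      also have "\<dots> = v * (y2\<^sup>2 - m)"
        unfolding factor using v by (simp add: y2_def)
      finally show ?thesis using less by (simp add: field_simps)
    qed
    finally show ?thesis .
  qed
  moreover have "continuous_on {y1..y2} (\<lambda>y. y * rsum M (y\<^sup>2))"
  proof -
    have "\<forall>y\<in>{y1..y2}. \<forall>a\<in>#M. a < y\<^sup>2" using gt y1 by auto
    then have "continuous_on {y1..y2} (\<lambda>y. rsum M (y\<^sup>2))"
    proof (induction M)
      case (add a M)
      then have "\<forall>y\<in>{y1..y2}. y\<^sup>2 - a \<noteq> 0" by fastforce
      then show ?case
        unfolding rsum_add using add by (intro continuous_intros) auto
    qed simp
    then show ?thesis by (intro continuous_intros)
  qed
  ultimately obtain y where y: "y1 \<le> y" "y \<le> y2" "y * rsum M (y\<^sup>2) = v"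
    using IVT2'[of "\<lambda>y. y * rsum M (y\<^sup>2)" y2 v y1] y12 by blast
  with y1 s gt[of y] show ?thesis by (intro that[of y]) auto
qed

text \<open>Strict decrease beyond the largest root makes the solution found there the greatest one,
  so \<open>GREATEST\<close> is attained.\<close>

lemma K_transform_sq_subst:
  assumes M: "\<forall>a\<in>#M. a \<ge> 0" "M \<noteq> {#}" and w: "w > 0"
  defines "y \<equiv> K_transform (sq_subst (root_poly M)) w"
  shows "y > 0" "\<forall>a\<in>#M. a < y\<^sup>2" "y * rsum M (y\<^sup>2) = real (size M) * w"
proof -
  have n: "real (size M) > 0" using M(2) by (simp add: nonempty_has_size)
  obtain k where k: "k > 0" "\<forall>a\<in>#M. a < k\<^sup>2" "k * rsum M (k\<^sup>2) = real (size M) * w"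
    using exists_rsum_sq_eq[OF M, of "real (size M) * w"] n w by auto
  have "y = k"
    unfolding y_def K_transform_def
  proof (rule Greatest_equality)
    have "k\<^sup>2 \<notin># M" using k(2) by auto
    then show "poly (sq_subst (root_poly M)) k \<noteq> 0 \<and> cauchy_transform (sq_subst (root_poly M)) k = w"
      using k n M by (simp add: poly_sq_subst poly_root_poly_eq_0_iff cauchy_transform_sq_subst)
  next
    fix x assume x: "poly (sq_subst (root_poly M)) x \<noteq> 0 \<and> cauchy_transform (sq_subst (root_poly M)) x = w"
    show "x \<le> k"
    proof (rule ccontr)
      assume "\<not> x \<le> k"
      then have "x * rsum M (x\<^sup>2) < k * rsum M (k\<^sup>2)"
        using k M by (intro rsum_sq_strict_antimono) auto
      moreover have "x\<^sup>2 \<notin># M" using x by (simp add: poly_sq_subst poly_root_poly_eq_0_iff)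
      then have "x * rsum M (x\<^sup>2) = real (size M) * w"
        using x n M by (auto simp: cauchy_transform_sq_subst)
      ultimately show False using k by simp
    qed
  qed
  with k show "y > 0" "\<forall>a\<in>#M. a < y\<^sup>2" "y * rsum M (y\<^sup>2) = real (size M) * w" by auto
qed

lemma barrier_iff_K_transform_le:
  assumes M: "\<forall>a\<in>#M. a \<ge> 0" "size M = d" "d \<ge> 1" and w: "w > 0"
  shows "barrier (1 / (2 * real d * w)) (root_poly M) y \<longleftrightarrow> K_transform (sq_subst (root_poly M)) w \<le> y"
proof -
  define k where "k = K_transform (sq_subst (root_poly M)) w"
  have ne: "M \<noteq> {#}" using M by auto
  note k = K_transform_sq_subst[OF M(1) ne w, folded k_def, unfolded M(2)]
  have dw: "real d * w > 0" using M w by simp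
  have bar: "barrier (1 / (2 * real d * w)) (root_poly M) y
      \<longleftrightarrow> y > 0 \<and> (\<forall>a\<in>#M. a < y\<^sup>2) \<and> y * rsum M (y\<^sup>2) \<le> real d * w" for y
    unfolding barrier_root_poly_iff using dw by (simp add: field_simps)
  show ?thesis
    unfolding bar k_def[symmetric]
  proof
    assume y: "y > 0 \<and> (\<forall>a\<in>#M. a < y\<^sup>2) \<and> y * rsum M (y\<^sup>2) \<le> real d * w"
    show "k \<le> y"
    proof (rule ccontr)
      assume "\<not> k \<le> y"
      then have "k * rsum M (k\<^sup>2) < y * rsum M (y\<^sup>2)"
        using y M ne by (intro rsum_sq_strict_antimono) auto
      with y k show False by simp
    qed
  next
    assume "k \<le> y"
    then have "k\<^sup>2 \<le> y\<^sup>2" using k(1) by (intro power_mono) auto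
    moreover have "y * rsum M (y\<^sup>2) \<le> k * rsum M (k\<^sup>2)"
      using rsum_sq_strict_antimono[of M k y] \<open>k \<le> y\<close> k M ne by (cases "k = y") auto
    ultimately show "y > 0 \<and> (\<forall>a\<in>#M. a < y\<^sup>2) \<and> y * rsum M (y\<^sup>2) \<le> real d * w"
      using k \<open>k \<le> y\<close> by (auto intro: less_le_trans)
  qed
qed

theorem theorem1p8:
  fixes p q :: "real poly" and d :: nat and w :: real
  assumes "d \<ge> 1"
    and "degree p = d" and "lead_coeff p = 1" and "only_nonneg_real_roots p"
    and "degree q = d" and "lead_coeff q = 1" and "only_nonneg_real_roots q"
    and "w > 0"
  shows "R_transform (sq_subst (asym_add_conv d p q)) w
           \<le> R_transform (sq_subst p) w + R_transform (sq_subst q) w"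
proof -
  obtain M where p: "p = root_poly M" "\<forall>a\<in>#M. a \<ge> 0"
    using assms monic_nonneg_real_rooted_factorization by blast
  obtain K where q: "q = root_poly K" "\<forall>a\<in>#K. a \<ge> 0"
    using assms monic_nonneg_real_rooted_factorization by blast
  have size: "size M = d" "size K = d" using assms p(1) q(1) by simp_all
  define r where "r = asym_add_conv d p q"
  have "only_nonneg_real_roots r"
    unfolding r_def p(1) q(1) using p q size by (intro only_nonneg_real_roots_asym_add_conv)
  moreover have r_monic: "degree r = d" "lead_coeff r = 1"
    unfolding r_def using assms asym_add_conv_monic[of p d q] by auto
  ultimately obtain L where r: "r = root_poly L" "\<forall>a\<in>#L. a \<ge> 0"
    using monic_nonneg_real_rooted_factorization by blast
  have sizeL: "size L = d" using r_monic r(1) by simp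
  define \<alpha> where "\<alpha> = 1 / (2 * real d * w)"
  have \<alpha>: "\<alpha> > 0" "2 * real d * \<alpha> = 1 / w" using assms(1,8) by (simp_all add: \<alpha>_def)
  define s where "s = K_transform (sq_subst p) w"
  define t where "t = K_transform (sq_subst q) w"
  have "barrier \<alpha> (root_poly M) s" "barrier \<alpha> (root_poly K) t"
    unfolding \<alpha>_def s_def t_def p(1) q(1)
    using p q size assms(1,8) by (simp_all add: barrier_iff_K_transform_le)
  then have "barrier \<alpha> r (s + t - 1 / w)"
    unfolding r_def p(1) q(1) \<alpha>(2)[symmetric]
    using \<alpha>(1) assms(1) p q size by (intro barrier_asym_add_conv)
  \<comment> \<open>Each of the three R-transforms subtracts 1 / w; the surplus one on the right is
    the barrier shift 2 d \<alpha>.\<close>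
  then have "K_transform (sq_subst r) w \<le> s + t - 1 / w"
    unfolding r(1) \<alpha>_def using r sizeL assms(1,8) by (subst (asm) barrier_iff_K_transform_le) auto
  then show ?thesis
    unfolding R_transform_def r_def s_def t_def by simp
qed

end
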